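(* Let $k=2$, suppose that $k\gamma_k^*<2$ (that is, $2\gamma_2^*<2$), and suppose that the mean LCS-function $\gamma_2:(-1,1)\to\mathbb{R}$ is differentiable at $p_M$. Let $1/2<\alpha<\beta<1$, and let $\tilde c_H>0$ be any constant, independent of $d$, with $\tilde c_H<\frac{3\gamma_2^*}{2}-1$. Then there exist constants $C_G>0$ and $C_H>0$, independent of $d$, such that $$\mathbb{P}(G^d)\ \ge\ 1-e^{-C_G d^{2\alpha-1}}\qquad\text{and}\qquad \mathbb{P}(H^d)\ \ge\ 1-e^{-C_H d^{2\alpha-1}}$$ for all $d\ge1$, where $$G^d=\left\{|LCS(X;Y)|>|LCS(X_1X_2\ldots X_{d-(\ell/2)}X_{d-(\ell/2)+d^{\alpha}+1}X_{d-(\ell/2)+d^{\alpha}+2}\ldots X_{2d};Y)|\right\},$$ $$H^d=\left\{|LCS(X^*;Y)|-|LCS(X;Y)|\ \ge\ \tilde c_H d^{\beta}\right\}.$$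
   Context: For finite strings $x,y$, $|LCS(x;y)|$ denotes the length of a longest common subsequence (subsequences need not be contiguous). Mean LCS-function. Let $(U_i)_{i\ge1}$ and $(V_i)_{i\ge1}$ be two independent sequences of iid random variables uniformly distributed on an alphabet of size $k$ (here $k=2$). For $p\in(-1,1)$ put $$\gamma_k(n,p)=\frac{\mathbb{E}|LCS(U_1\ldots U_{n-np};V_1\ldots V_{n+np})|}{n},\qquad \gamma_k(p)=\lim_{n\to\infty}\gamma_k(n,p),$$ and $\gamma_k^*=\lim_{n\to\infty}\mathbb{E}|LCS(U_1\ldots U_n;V_1\ldots V_n)|/n=\gamma_k(0)$ (these limits exist). The function $\gamma_k$ is concave and symmetric about $0$, hence maximal at $0$. Let $p_M\in[0,1)$ be the largest real at which $\gamma_k$ attains its maximal value $\gamma_k(0)$, so that $[-p_M,p_M]=\gamma_k^{-1}(\{\gamma_k(0)\})$. Model. $X=X_1\ldots X_{2d}$ and $Y=Y_1\ldots Y_{2d}$ are two independent random strings of length $2d$ over an alphabet of size $k=2$. The string $Y$ is iid uniform. A long constant block of length $\ell=d^{\beta}$ ($\ell$ even) is inserted in the middle of $X$: almost surely $X_{d-(\ell/2)+1}=X_{d-(\ell/2)+2}=\cdots=X_{d+(\ell/2)}$. The strings $Y$, $X_1\ldots X_{d-(\ell/2)}$ and $X_{d+(\ell/2)+1}\ldots X_{2d}$ are three independent strings of iid uniform letters. The string $X^*=X_1^*\ldots X_{2d}^*$ is obtained from $X$ by replacing the constant block by iid uniform letters: $X_i^*=X_i$ for $i\in[1,d-(\ell/2)]\cup[d+(\ell/2)+1,2d]$,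 and the whole string $X^*$ is iid uniform and independent of $Y$. The second string in the definition of $G^d$ is $X$ with the piece $X_{d-(\ell/2)+1}\ldots X_{d-(\ell/2)+d^\alpha}$ of the block removed. Convention: real numbers used as lengths or indices (such as $d^\alpha$, $d^\beta$, $n\pm np$) are understood to be rounded to the nearest positive integers, with $\ell$ taken even. *)

theory Defs
  imports "HOL-Probability.Probability" "HOL-Library.Sublist"
begin

definition lcs_length :: "'a list \<Rightarrow> 'a list \<Rightarrow> nat" where
  "lcs_length xs ys = Max {length zs | zs. subseq zs xs \<and> subseq zs ys}"

text \<open>Real numbers used as lengths or indices are rounded to the nearest positive integer; the
  length of the constant block to the nearest positive even integer (ties go up).\<close>

definition round_pos :: "real \<Rightarrow> nat" where
  "round_pos x = max 1 (nat (round x))"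

definition round_even :: "real \<Rightarrow> nat" where
  "round_even x = 2 * round_pos (x / 2)"

definition uniform_words :: "nat \<Rightarrow> nat \<Rightarrow> nat list pmf" where
  "uniform_words k n = replicate_pmf n (pmf_of_set {..<k})"

text \<open>\<open>U\<^sub>1 \<dots> U\<^sub>m\<close> and \<open>V\<^sub>1 \<dots> V\<^sub>n\<close> are independent with iid uniform letters from \<open>{..<k}\<close>.\<close>

definition mean_lcs :: "nat \<Rightarrow> nat \<Rightarrow> nat \<Rightarrow> real" where
  "mean_lcs k m n =
     measure_pmf.expectation (pair_pmf (uniform_words k m) (uniform_words k n))
       (\<lambda>(u, v). real (lcs_length u v))"

definition gamma_n :: "nat \<Rightarrow> nat \<Rightarrow> real \<Rightarrow> real" where
  "gamma_n k n p =
     mean_lcs k (round_pos (real n - real n * p)) (round_pos (real n + real n * p)) / real n"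

text \<open>Only the values on \<open>(-1, 1)\<close> are meaningful.\<close>

definition gamma :: "nat \<Rightarrow> real \<Rightarrow> real" where
  "gamma k p = lim (\<lambda>n. gamma_n k n p)"

definition gamma_star :: "nat \<Rightarrow> real" where
  "gamma_star k = lim (\<lambda>n. mean_lcs k n n / real n)"

definition p_M :: "nat \<Rightarrow> real" where
  "p_M k = (GREATEST p. p \<in> {-1<..<1} \<and> gamma k p = gamma k 0)"

text \<open>Letters are indexed from 1; \<open>word Z i j \<omega>\<close> is the string \<open>Z\<^sub>i \<dots> Z\<^sub>j\<close>, empty if \<open>j < i\<close>.\<close>

definition word :: "(nat \<Rightarrow> 'w \<Rightarrow> 'a) \<Rightarrow> nat \<Rightarrow> nat \<Rightarrow> 'w \<Rightarrow> 'a list" where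
  "word Z i j \<omega> = map (\<lambda>m. Z m \<omega>) [i..<Suc j]"

definition iid_uniform :: "'w measure \<Rightarrow> nat \<Rightarrow> nat set \<Rightarrow> (nat \<Rightarrow> 'w \<Rightarrow> nat) \<Rightarrow> bool" where
  "iid_uniform M k I Z \<longleftrightarrow>
     prob_space.indep_vars M (\<lambda>_. count_space UNIV) Z I \<and>
     (\<forall>i\<in>I. distr M (count_space UNIV) (Z i) = measure_pmf (pmf_of_set {..<k}))"

text \<open>Nothing is assumed about the law of the letter filling the constant block, nor about how it
  depends on the rest of \<open>X\<close> or on \<open>Xs\<close> (the string \<open>X\<^sup>*\<close>).
  For \<open>d \<ge> 1\<close> and \<open>\<beta> < 1\<close> we have \<open>l \<le> 2 * d\<close>, so the subtraction \<open>d - l div 2\<close> does not truncate.\<close>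

locale block_model = prob_space M
  for M :: "'w measure" +
  fixes k d l :: nat and X Y Xs :: "nat \<Rightarrow> 'w \<Rightarrow> nat"
  assumes letters_X: "\<And>i. i \<in> {1..2*d} \<Longrightarrow> X i \<in> measurable M (count_space {..<k})"
    and letters_Y: "\<And>i. i \<in> {1..2*d} \<Longrightarrow> Y i \<in> measurable M (count_space {..<k})"
    and letters_Xs: "\<And>i. i \<in> {1..2*d} \<Longrightarrow> Xs i \<in> measurable M (count_space {..<k})"
    and indep_X_Y:
      "indep_var (count_space UNIV) (word X 1 (2*d)) (count_space UNIV) (word Y 1 (2*d))"
    and block_constant:
      "AE \<omega> in M. \<forall>i\<in>{d - l div 2 + 1..d + l div 2}. X i \<omega> = X (d - l div 2 + 1) \<omega>"
    and iid_Y: "iid_uniform M k {1..2*d} Y"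
    and iid_left: "iid_uniform M k {1..d - l div 2} X"
    and iid_right: "iid_uniform M k {d + l div 2 + 1..2*d} X"
    and indep_three:
      "indep_vars (\<lambda>_. count_space UNIV)
         (\<lambda>j. [word Y 1 (2*d), word X 1 (d - l div 2), word X (d + l div 2 + 1) (2*d)] ! j) {..<3}"
    and Xs_eq: "\<And>i \<omega>. i \<in> {1..d - l div 2} \<union> {d + l div 2 + 1..2*d} \<Longrightarrow> \<omega> \<in> space M \<Longrightarrow> Xs i \<omega> = X i \<omega>"
    and iid_Xs: "iid_uniform M k {1..2*d} Xs"
    and indep_Xs_Y:
      "indep_var (count_space UNIV) (word Xs 1 (2*d)) (count_space UNIV) (word Y 1 (2*d))"

definition G_event :: "'w measure \<Rightarrow> nat \<Rightarrow> nat \<Rightarrow> nat \<Rightarrow>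
    (nat \<Rightarrow> 'w \<Rightarrow> nat) \<Rightarrow> (nat \<Rightarrow> 'w \<Rightarrow> nat) \<Rightarrow> 'w set" where
  "G_event M d l a X Y =
     {\<omega> \<in> space M. lcs_length (word X 1 (2*d) \<omega>) (word Y 1 (2*d) \<omega>) >
        lcs_length (word X 1 (d - l div 2) \<omega> @ word X (d - l div 2 + a + 1) (2*d) \<omega>)
          (word Y 1 (2*d) \<omega>)}"

definition H_event :: "'w measure \<Rightarrow> nat \<Rightarrow> real \<Rightarrow>
    (nat \<Rightarrow> 'w \<Rightarrow> nat) \<Rightarrow> (nat \<Rightarrow> 'w \<Rightarrow> nat) \<Rightarrow> (nat \<Rightarrow> 'w \<Rightarrow> nat) \<Rightarrow> 'w set" where
  "H_event M d t X Y Xs =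
     {\<omega> \<in> space M. real (lcs_length (word Xs 1 (2*d) \<omega>) (word Y 1 (2*d) \<omega>))
        - real (lcs_length (word X 1 (2*d) \<omega>) (word Y 1 (2*d) \<omega>)) \<ge> t}"

end

theory Submission
  imports Defs "HOL-Real_Asymp.Real_Asymp"
begin

text \<open>
  Let \<open>f m n\<close> be the mean LCS length of uniform binary words of lengths \<open>m\<close> and \<open>n\<close>. Exchanging the
  tails of two crossing alignments shows that the LCS length has the Monge property, so that \<open>f m\<close> is a
  concave sequence. This has two consequences. First, \<open>f n i + f n (2 * n - i) \<le> 2 * f n n\<close>; with
  the subgaussian concentration of the LCS length, \<open>f (2 * n) (2 * n) \<le> 2 * f n n + O(sqrt n * ln n)\<close>, and
  \<open>f n n\<close> differs from \<open>\<gamma> * n\<close> by \<open>O(n powr \<alpha>)\<close>, where \<open>\<gamma>\<close> is \<open>gamma_star 2\<close>. Second, if \<open>gamma 2\<close> is differentiable at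
  \<open>p_M 2\<close>, then either \<open>gamma 2\<close> attains its maximum at some \<open>p \<noteq> 0\<close> or its derivative at \<open>0\<close> vanishes. In both
  cases the increments of \<open>f m\<close> slightly below the diagonal, and hence all later ones, stay below some
  \<open>\<kappa> < 1 / 2\<close>.

  With the required probability all prefixes and suffixes of \<open>Y\<close> have letter counts and LCS lengths
  within a small multiple of \<open>d powr \<alpha>\<close> of their means. An alignment of \<open>X\<close> that matches the block to a segment
  of length \<open>s\<close> of \<open>Y\<close> then has length at most about \<open>\<gamma> * (2 * d - (l + s) / 2) + min l (s / 2)\<close>, and \<open>s = 2 * l\<close> is optimal.
  Comparison with the mean for \<open>X\<^sup>*\<close> gives \<open>H\<close>. For \<open>G\<close>, enlarging the segment by \<open>a\<close> letters gains
  about \<open>a / 2\<close> block letters and costs at most about \<open>\<kappa> * a\<close>.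

  For small \<open>d\<close> both events merely need a probability bounded away from \<open>0\<close>. For \<open>H\<close> this uses
  \<open>\<gamma> \<le> 8 / 9\<close>, which follows by counting the words that contain a given subsequence: it ensures
  \<open>c\<^sub>H * d powr \<beta> \<le> l / 2\<close>.
\<close>

subsection \<open>Longest common subsequences\<close>

lemma finite_common_subseqs: "finite {length zs | zs. subseq zs xs \<and> subseq zs ys}"
  by (rule finite_subset[of _ "{..length xs}"]) (auto dest: list_emb_length)

lemma lcs_length_ge: "subseq zs xs \<Longrightarrow> subseq zs ys \<Longrightarrow> length zs \<le> lcs_length xs ys"
  unfolding lcs_length_def by (intro Max_ge finite_common_subseqs) auto

lemma lcs_lengthE:
  obtains zs where "subseq zs xs" "subseq zs ys" "length zs = lcs_length xs ys"
proof -
  have "lcs_length xs ys \<in> {length zs | zs. subseq zs xs \<and> subseq zs ys}"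
    unfolding lcs_length_def by (intro Max_in finite_common_subseqs) (auto intro!: exI[of _ "[]"])
  then show ?thesis using that by auto
qed

lemma lcs_length_mono:
  assumes "subseq xs xs'" "subseq ys ys'"
  shows "lcs_length xs ys \<le> lcs_length xs' ys'"
  by (metis assms lcs_lengthE lcs_length_ge subseq_order.order_trans)

lemma lcs_length_commute: "lcs_length xs ys = lcs_length ys xs"
  unfolding lcs_length_def by (rule arg_cong[where f = Max]) auto

lemma lcs_length_le_left: "lcs_length xs ys \<le> length xs"
  by (metis lcs_lengthE list_emb_length)

lemma lcs_length_Nil [simp]: "lcs_length [] ys = 0"
  using lcs_length_le_left[of "[]" ys] by simp

lemma lcs_length_self [simp]: "lcs_length xs xs = length xs"
  using lcs_length_ge[of xs xs xs] lcs_length_le_left[of xs xs] by simp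

lemma lcs_length_append_ge:
  "lcs_length xs ys + lcs_length xs' ys' \<le> lcs_length (xs @ xs') (ys @ ys')"
proof -
  obtain zs zs' where "subseq zs xs" "subseq zs ys" "length zs = lcs_length xs ys"
    "subseq zs' xs'" "subseq zs' ys'" "length zs' = lcs_length xs' ys'"
    by (meson lcs_lengthE)
  then show ?thesis
    using lcs_length_ge[of "zs @ zs'" "xs @ xs'" "ys @ ys'"] by (simp add: list_emb_append_mono)
qed

lemma lcs_length_append_split:
  obtains i where "i \<le> length ys"
    "lcs_length (xs @ xs') ys = lcs_length xs (take i ys) + lcs_length xs' (drop i ys)"
proof -
  obtain zs where zs: "subseq zs (xs @ xs')" "subseq zs ys" "length zs = lcs_length (xs @ xs') ys"
    by (rule lcs_lengthE)
  then obtain z z' where z: "zs = z @ z'" "subseq z xs" "subseq z' xs'"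
    by (auto elim: subseq_appendE)
  then obtain y y' where y: "ys = y @ y'" "subseq z y" "subseq z' y'"
    using zs(2) by (metis list_emb_appendD)
  have "length z \<le> lcs_length xs y" "length z' \<le> lcs_length xs' y'"
    using z y by (auto intro: lcs_length_ge)
  moreover have "lcs_length xs y + lcs_length xs' y' \<le> lcs_length (xs @ xs') ys"
    using y by (simp add: lcs_length_append_ge)
  ultimately show ?thesis
    using that[of "length y"] y z zs by simp
qed

lemma lcs_length_Cons_le: "lcs_length (x # xs) ys \<le> Suc (lcs_length xs ys)"
proof -
  obtain i where "lcs_length ([x] @ xs) ys = lcs_length [x] (take i ys) + lcs_length xs (drop i ys)"
    by (rule lcs_length_append_split)
  moreover have "lcs_length [x] (take i ys) \<le> 1"
    using lcs_length_le_left[of "[x]"] by simp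
  moreover have "lcs_length xs (drop i ys) \<le> lcs_length xs ys"
    by (intro lcs_length_mono) auto
  ultimately show ?thesis by simp
qed

lemma lcs_length_insert_le: "lcs_length (p @ x # q) ys \<le> Suc (lcs_length (p @ q) ys)"
proof -
  obtain i where "lcs_length (p @ x # q) ys = lcs_length p (take i ys) + lcs_length (x # q) (drop i ys)"
    by (rule lcs_length_append_split)
  also have "\<dots> \<le> Suc (lcs_length p (take i ys) + lcs_length q (drop i ys))"
    using lcs_length_Cons_le by simp
  also have "\<dots> \<le> Suc (lcs_length (p @ q) ys)"
    using lcs_length_append_ge[of p "take i ys" q "drop i ys"] by simp
  finally show ?thesis .
qed

text \<open>Both words arise from \<open>p @ q\<close> by inserting one letter, which raises the LCS
  length by at most 1. This is the bounded difference property on which concentration rests.\<close>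

lemma lcs_length_subst_left:
  "\<bar>real (lcs_length (p @ x # q) ys) - real (lcs_length (p @ x' # q) ys)\<bar> \<le> 1"
proof -
  have "lcs_length (p @ q) ys \<le> lcs_length (p @ c # q) ys" for c
    by (intro lcs_length_mono list_emb_append_mono) auto
  then show ?thesis
    using lcs_length_insert_le[of p x q ys] lcs_length_insert_le[of p x' q ys]
    by (smt (verit) of_nat_Suc of_nat_mono)
qed

lemma lcs_length_subst_right:
  "\<bar>real (lcs_length ys (p @ x # q)) - real (lcs_length ys (p @ x' # q))\<bar> \<le> 1"
  using lcs_length_subst_left[of p x q ys x'] by (simp add: lcs_length_commute)

text \<open>A common subsequence with a constant word uses only the letter \<open>b\<close>, so that
  aligning the block reduces to counting a letter.\<close>

lemma lcs_length_replicate: "lcs_length (replicate l b) ys = min l (count_list ys b)"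
proof (rule antisym)
  obtain zs where zs: "subseq zs (replicate l b)" "subseq zs ys"
    "length zs = lcs_length (replicate l b) ys" by (rule lcs_lengthE)
  have "\<And>z. z \<in> set zs \<Longrightarrow> z = b"
    using list_emb_set[OF zs(1)] by (metis in_set_replicate)
  then have "filter ((=) b) zs = zs" by (auto intro: filter_True)
  then have "subseq zs (filter ((=) b) ys)"
    using zs(2) by (metis subseq_filter)
  then show "lcs_length (replicate l b) ys \<le> min l (count_list ys b)"
    using zs(3) lcs_length_le_left[of "replicate l b" ys] list_emb_length
    by (fastforce simp: count_list_eq_length_filter)
next
  let ?n = "min l (count_list ys b)"
  have "filter ((=) b) ys = replicate (count_list ys b) b"
    unfolding count_list_eq_length_filter by (rule replicate_eqI) auto
  then have "subseq (replicate (count_list ys b) b) ys"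
    by (metis subseq_filter_left)
  moreover have "subseq (replicate ?n b) (replicate m b)" if "?n \<le> m" for m
  proof -
    have "replicate m b = replicate ?n b @ replicate (m - ?n) b"
      using that by (simp flip: replicate_add)
    then show ?thesis by (simp add: subseq_rev_drop_many)
  qed
  ultimately have "subseq (replicate ?n b) (replicate l b)" "subseq (replicate ?n b) ys"
    by (blast intro: subseq_order.order_trans min.cobounded1 min.cobounded2)+
  then show "?n \<le> lcs_length (replicate l b) ys"
    using lcs_length_ge by fastforce
qed

section \<open>Monge property of the LCS length\<close>

lemma lcs_length_Cons_match: "Suc (lcs_length xs q) \<le> lcs_length (x # xs) (p @ x # q)"
proof -
  have "subseq [x] (p @ [x])" by (simp add: subseq_singleton_left)
  then have "1 \<le> lcs_length [x] (p @ [x])" using lcs_length_ge[of "[x]" "[x]" "p @ [x]"] by simp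
  then show ?thesis using lcs_length_append_ge[of "[x]" "p @ [x]" xs q] by simp
qed

text \<open>An optimal alignment either ignores \<open>x\<close> or matches it, after which only the
  letters behind the match remain. This recursion drives the induction for the Monge
  property.\<close>

lemma lcs_length_Cons_cases:
  obtains (skip) "lcs_length (x # xs) ys = lcs_length xs ys"
    | (match) p q where "ys = p @ x # q" "lcs_length (x # xs) ys = Suc (lcs_length xs q)"
proof -
  obtain i where i: "lcs_length ([x] @ xs) ys = lcs_length [x] (take i ys) + lcs_length xs (drop i ys)"
    by (rule lcs_length_append_split)
  have mono: "lcs_length xs (drop i ys) \<le> lcs_length xs ys" "lcs_length xs ys \<le> lcs_length (x # xs) ys"
    by (intro lcs_length_mono; auto)+
  show ?thesis
  proof (cases "x \<in> set (take i ys)")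
    case False
    then have "lcs_length [x] (take i ys) = 0"
      using lcs_length_replicate[of 1 x "take i ys"] by (simp add: count_list_0_iff)
    then show ?thesis using skip mono i by simp
  next
    case True
    then obtain p r where pr: "take i ys = p @ x # r" by (metis split_list)
    then have ys: "ys = p @ x # (r @ drop i ys)"
      by (metis append_Cons append_assoc append_take_drop_id)
    have "lcs_length [x] (take i ys) \<le> 1" using lcs_length_le_left[of "[x]"] by simp
    moreover have "lcs_length xs (drop i ys) \<le> lcs_length xs (r @ drop i ys)"
      by (intro lcs_length_mono) auto
    moreover have "Suc (lcs_length xs (r @ drop i ys)) \<le> lcs_length (x # xs) ys"
      using lcs_length_Cons_match[of xs "r @ drop i ys" x p] ys by simp
    ultimately show ?thesis using match[OF ys] i by simp
  qed
qed

lemma lcs_length_Cons_skip: "lcs_length xs ys \<le> lcs_length (x # xs) ys"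
  by (intro lcs_length_mono) auto

lemma append_eq_append_Cons_cases:
  assumes "xs @ ys = p @ c # q"
  shows "(\<exists>q'. xs = p @ c # q' \<and> q = q' @ ys) \<or> (\<exists>r. ys = r @ c # q)"
proof -
  obtain us where "xs = p @ us \<and> us @ ys = c # q \<or> xs @ us = p \<and> ys = us @ c # q"
    using assms by (auto simp: append_eq_append_conv2)
  then show ?thesis by (cases us) auto
qed

text \<open>An alignment with \<open>y1 @ y2 @ y3\<close> must cross an alignment with \<open>y2\<close>; exchanging their tails at
  the crossing gives alignments with \<open>y1 @ y2\<close> and \<open>y2 @ y3\<close>.\<close>

lemma lcs_length_Monge:
  "lcs_length x (y1 @ y2 @ y3) + lcs_length x y2 \<le> lcs_length x (y1 @ y2) + lcs_length x (y2 @ y3)"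
proof (induction x arbitrary: y1 y2 y3)
  case (Cons c x)
  note skip = lcs_length_Cons_skip[of x _ c] and match = lcs_length_Cons_match[of x _ c]
  show ?case
  proof (cases rule: lcs_length_Cons_cases[of c x y2])
    case B: skip
    show ?thesis
    proof (cases rule: lcs_length_Cons_cases[of c x "y1 @ y2 @ y3"])
      case A: skip
      show ?thesis
        using Cons.IH[of y1 y2 y3] A B skip[of "y1 @ y2"] skip[of "y2 @ y3"] by linarith
    next
      case A: (match p q)
      then consider q' where "y1 = p @ c # q'" "q = q' @ y2 @ y3" | r where "y2 @ y3 = r @ c # q"
        by (metis append_eq_append_Cons_cases)
      then show ?thesis
      proof cases
        case 1
        then show ?thesis
          using Cons.IH[of q' y2 y3] A B skip[of "y2 @ y3"] match[of "q' @ y2" p] by simp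
      next
        case 2
        \<comment> \<open>No tails need exchanging here: the longer alignment lies in
          \<open>y2 @ y3\<close> and the shorter one in \<open>y1 @ y2\<close>.\<close>
        have "lcs_length x y2 \<le> lcs_length (c # x) (y1 @ y2)"
          using lcs_length_mono[of x "c # x" y2 "y1 @ y2"] by auto
        then show ?thesis using A B match[of q r] 2 by simp
      qed
    qed
  next
    case B: (match r s)
    have B': "Suc (lcs_length x s) \<le> lcs_length (c # x) (y1 @ y2)"
      using match[of s "y1 @ r"] B by simp
    show ?thesis
    proof (cases rule: lcs_length_Cons_cases[of c x "y1 @ y2 @ y3"])
      case A: skip
      \<comment> \<open>The letters of \<open>y2\<close> up to the match move into
        \<open>y1\<close>, which leaves \<open>s\<close> as the middle part for the induction
        hypothesis.\<close>
      show ?thesis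
        using Cons.IH[of "y1 @ r @ [c]" s y3] A B match[of "s @ y3" r] skip[of "y1 @ y2"] by simp
    next
      case A: (match p q)
      then consider q' where "y1 = p @ c # q'" "q = q' @ y2 @ y3" | t where "y2 @ y3 = t @ c # q"
        by (metis append_eq_append_Cons_cases)
      then show ?thesis
      proof cases
        case 1
        then show ?thesis
          using Cons.IH[of "q' @ r @ [c]" s y3] A B match[of "q' @ y2" p] match[of "s @ y3" r] by simp
      next
        case 2
        then show ?thesis using A B B' match[of q t] by simp
      qed
    qed
  qed
qed simp

subsection \<open>Means over binary words\<close>

text \<open>The expectation over uniform binary words as a recursion on the first letter, so that
  induction on \<open>n\<close> replaces conditioning on one letter after another.\<close>

primrec avg :: "nat \<Rightarrow> (nat list \<Rightarrow> real) \<Rightarrow> real" where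
  "avg 0 F = F []"
| "avg (Suc n) F = (avg n (\<lambda>w. F (0 # w)) + avg n (\<lambda>w. F (1 # w))) / 2"

definition binary_words :: "nat \<Rightarrow> nat list set" where
  "binary_words n = {w. set w \<subseteq> {..<2} \<and> length w = n}"

lemma binary_words_0 [simp]: "binary_words 0 = {[]}"
  by (auto simp: binary_words_def)

lemma binary_words_Suc:
  "binary_words (Suc n) = (#) 0 ` binary_words n \<union> (#) 1 ` binary_words n"
proof -
  have "w \<in> (#) 0 ` binary_words n \<union> (#) 1 ` binary_words n" if "w \<in> binary_words (Suc n)" for w
    using that by (cases w) (auto simp: binary_words_def less_2_cases_iff)
  then show ?thesis by (auto simp: binary_words_def)
qed

lemma finite_binary_words [simp]: "finite (binary_words n)"
  unfolding binary_words_def using finite_lists_length_eq[of "{..<2::nat}" n] by simp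

lemma card_binary_words: "card (binary_words n) = 2 ^ n"
  unfolding binary_words_def using card_lists_length_eq[of "{..<2::nat}" n] by simp

lemma avg_eq_sum: "avg n F = (\<Sum>w\<in>binary_words n. F w) / 2 ^ n"
proof (induction n arbitrary: F)
  case (Suc n)
  have "(\<Sum>w\<in>binary_words (Suc n). F w)
      = (\<Sum>w\<in>binary_words n. F (0 # w)) + (\<Sum>w\<in>binary_words n. F (1 # w))"
    unfolding binary_words_Suc
    by (subst sum.union_disjoint) (auto simp: sum.reindex)
  then show ?case by (simp add: Suc add_divide_distrib mult.commute)
qed simp

lemma avg_cong: "(\<And>w. w \<in> binary_words n \<Longrightarrow> F w = G w) \<Longrightarrow> avg n F = avg n G"
  unfolding avg_eq_sum by (simp cong: sum.cong)

lemma avg_mono: "(\<And>w. w \<in> binary_words n \<Longrightarrow> F w \<le> G w) \<Longrightarrow> avg n F \<le> avg n G"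
  unfolding avg_eq_sum by (intro divide_right_mono sum_mono) auto

lemma avg_const [simp]: "avg n (\<lambda>_. c) = c"
  by (induction n) auto

lemma avg_add: "avg n (\<lambda>w. F w + G w) = avg n F + avg n G"
  unfolding avg_eq_sum by (simp add: sum.distrib add_divide_distrib)

lemma avg_diff: "avg n (\<lambda>w. F w - G w) = avg n F - avg n G"
  unfolding avg_eq_sum by (simp add: sum_subtractf diff_divide_distrib)

lemma avg_cmult: "avg n (\<lambda>w. c * F w) = c * avg n F"
  unfolding avg_eq_sum by (simp add: sum_distrib_left)

lemma avg_sum: "avg n (\<lambda>w. \<Sum>i\<in>I. F i w) = (\<Sum>i\<in>I. avg n (F i))"
  unfolding avg_eq_sum by (subst sum.swap) (simp add: sum_divide_distrib)

lemma avg_append: "avg (m + n) F = avg m (\<lambda>u. avg n (\<lambda>v. F (u @ v)))"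
  by (induction m arbitrary: F) auto

lemma avg_swap: "avg m (\<lambda>u. avg n (\<lambda>v. F u v)) = avg n (\<lambda>v. avg m (\<lambda>u. F u v))"
  unfolding avg_eq_sum by (subst sum_divide_distrib[symmetric])
    (simp add: sum_divide_distrib[symmetric] sum.swap[of _ "binary_words m"] mult.commute)

lemma length_binary_words: "w \<in> binary_words n \<Longrightarrow> length w = n"
  by (simp add: binary_words_def)

lemma avg_take: assumes "i \<le> n" shows "avg n (\<lambda>v. F (take i v)) = avg i F"
proof -
  have "avg (i + (n - i)) (\<lambda>v. F (take i v)) = avg i (\<lambda>u. avg (n - i) (\<lambda>v. F u))"
    unfolding avg_append by (intro avg_cong) (simp add: length_binary_words)
  then show ?thesis using assms by simp
qed

lemma avg_drop: assumes "i \<le> n" shows "avg n (\<lambda>v. F (drop i v)) = avg (n - i) F"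
proof -
  have "avg (i + (n - i)) (\<lambda>v. F (drop i v)) = avg i (\<lambda>u. avg (n - i) F)"
    unfolding avg_append by (intro avg_cong) (simp add: length_binary_words)
  then show ?thesis using assms by simp
qed

section \<open>Exponential moments under bounded differences\<close>

definition word_lipschitz :: "('a list \<Rightarrow> real) \<Rightarrow> bool" where
  "word_lipschitz F \<longleftrightarrow> (\<forall>p q a b. \<bar>F (p @ a # q) - F (p @ b # q)\<bar> \<le> 1)"

text \<open>Hoeffding's lemma for a fair two-valued variable.\<close>

lemma exp_mean_le: "(exp x + exp y) / 2 \<le> exp ((x + y) / 2 + (x - y)\<^sup>2 / 8)" for x y :: real
proof -
  have *: "(exp x + exp y) / 2 \<le> exp ((x + y) / 2 + (x - y)\<^sup>2 / 8)" if "y \<le> x" for x y :: real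
  proof -
    have "- (x - y) * (1 / 2) + ln (1 + (1 / 2) * (exp (x - y) - 1)) \<le> (x - y)\<^sup>2 / 8"
      by (rule Hoeffdings_lemma_aux) (use that in auto)
    moreover have pos: "0 < 1 + (1 / 2) * (exp (x - y) - 1)"
      using that by (simp add: add_pos_nonneg)
    ultimately have "exp (ln (1 + (1 / 2) * (exp (x - y) - 1))) \<le> exp ((x - y) / 2 + (x - y)\<^sup>2 / 8)"
      by (subst exp_le_cancel_iff) linarith
    then have "1 + (1 / 2) * (exp (x - y) - 1) \<le> exp ((x - y) / 2 + (x - y)\<^sup>2 / 8)"
      by (subst (asm) exp_ln[OF pos])
    then have "exp y * (1 + (1 / 2) * (exp (x - y) - 1)) \<le> exp (y + ((x - y) / 2 + (x - y)\<^sup>2 / 8))"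
      unfolding exp_add by (intro mult_left_mono) auto
    moreover have "exp y * (1 + (1 / 2) * (exp (x - y) - 1)) = (exp x + exp y) / 2"
      by (simp add: algebra_simps exp_diff)
    moreover have "y + ((x - y) / 2 + (x - y)\<^sup>2 / 8) = (x + y) / 2 + (x - y)\<^sup>2 / 8"
      by (simp add: field_simps)
    ultimately show ?thesis by simp
  qed
  show ?thesis
    using *[of x y] *[of y x] by (cases "y \<le> x") (auto simp: power2_commute add.commute)
qed

text \<open>McDiarmid's exponential bound. The conditional means given the first letter differ by at
  most 1, so Hoeffding's lemma adds \<open>s\<^sup>2 / 8\<close> for each letter.\<close>

lemma avg_exp_le:
  assumes "word_lipschitz F"
  shows "avg n (\<lambda>w. exp (s * F w)) \<le> exp (s * avg n F + s\<^sup>2 * real n / 8)"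
  using assms
proof (induction n arbitrary: F)
  case (Suc n)
  define x where "x a = s * avg n (\<lambda>w. F (a # w))" for a :: nat
  have lip: "word_lipschitz (\<lambda>w. F (a # w))" for a
    using Suc.prems unfolding word_lipschitz_def by (metis append_Cons)
  have "avg n (\<lambda>w. F (0 # w) - F (1 # w)) \<le> avg n (\<lambda>_. 1)"
    "avg n (\<lambda>w. F (1 # w) - F (0 # w)) \<le> avg n (\<lambda>_. 1)"
    using Suc.prems unfolding word_lipschitz_def
    by (intro avg_mono, metis append_Nil abs_le_D1)+
  then have "\<bar>avg n (\<lambda>w. F (0 # w)) - avg n (\<lambda>w. F (1 # w))\<bar> \<le> 1"
    by (simp add: avg_diff)
  then have "(avg n (\<lambda>w. F (0 # w)) - avg n (\<lambda>w. F (1 # w)))\<^sup>2 \<le> 1"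
    by (simp add: abs_square_le_1)
  then have x: "(x 0 - x 1)\<^sup>2 \<le> s\<^sup>2"
    unfolding x_def by (metis mult.right_neutral mult_left_mono power_mult_distrib right_diff_distrib zero_le_power2)
  have "avg (Suc n) (\<lambda>w. exp (s * F w)) \<le> (exp (x 0 + s\<^sup>2 * real n / 8) + exp (x 1 + s\<^sup>2 * real n / 8)) / 2"
    using Suc.IH[OF lip[of 0]] Suc.IH[OF lip[of 1]] by (simp add: x_def)
  also have "\<dots> \<le> exp ((x 0 + x 1) / 2 + (x 0 - x 1)\<^sup>2 / 8 + s\<^sup>2 * real n / 8)"
    using exp_mean_le[of "x 0 + s\<^sup>2 * real n / 8" "x 1 + s\<^sup>2 * real n / 8"]
    by (simp add: add_divide_distrib ac_simps)
  also have "\<dots> \<le> exp (s * avg (Suc n) F + s\<^sup>2 * real (Suc n) / 8)"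
    using x by (simp add: x_def field_simps)
  finally show ?case .
qed simp

subsection \<open>The mean LCS function\<close>

lemma pmf_uniform_words: "pmf (uniform_words 2 n) w = of_bool (w \<in> binary_words n) / 2 ^ n"
proof (induction n arbitrary: w)
  case 0
  then show ?case by (auto simp: uniform_words_def pmf_return)
next
  case (Suc n)
  have eq: "uniform_words 2 (Suc n)
      = map_pmf (\<lambda>(x, xs). x # xs) (pair_pmf (pmf_of_set {..<2}) (uniform_words 2 n))"
    by (simp add: uniform_words_def pair_pmf_def map_bind_pmf)
  show ?case
  proof (cases w)
    case Nil
    then have "w \<notin> set_pmf (uniform_words 2 (Suc n))"
      unfolding eq by auto
    then show ?thesis using Nil by (simp add: set_pmf_iff binary_words_def)
  next
    case (Cons a v)
    have "pmf (uniform_words 2 (Suc n)) ((\<lambda>(x, xs). x # xs) (a, v))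
        = pmf (pair_pmf (pmf_of_set {..<2}) (uniform_words 2 n)) (a, v)"
      unfolding eq by (rule pmf_map_inj') (auto simp: inj_def)
    then show ?thesis
      using Cons Suc.IH[of v] by (auto simp: pmf_pair binary_words_def indicator_def lessThan_empty_iff)
  qed
qed

lemma mean_lcs_eq_avg:
  "mean_lcs 2 m n = avg m (\<lambda>u. avg n (\<lambda>v. real (lcs_length u v)))"
proof -
  have "mean_lcs 2 m n = (\<Sum>a\<in>binary_words m \<times> binary_words n.
      pmf (pair_pmf (uniform_words 2 m) (uniform_words 2 n)) a *\<^sub>R (case a of (u, v) \<Rightarrow> real (lcs_length u v)))"
    unfolding mean_lcs_def
    by (rule integral_measure_pmf)
      (auto simp: pmf_uniform_words set_pmf_iff split: if_splits)
  also have "\<dots> = (\<Sum>u\<in>binary_words m. \<Sum>v\<in>binary_words n. real (lcs_length u v) / 2 ^ n / 2 ^ m)"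
    unfolding sum.cartesian_product
    by (intro sum.cong) (auto simp: pmf_pair pmf_uniform_words mult.commute)
  also have "\<dots> = avg m (\<lambda>u. avg n (\<lambda>v. real (lcs_length u v)))"
    by (simp add: avg_eq_sum sum_divide_distrib)
  finally show ?thesis .
qed

abbreviation mlcs :: "nat \<Rightarrow> nat \<Rightarrow> real" where
  "mlcs \<equiv> mean_lcs 2"

lemma mlcs_nonneg: "0 \<le> mlcs m n"
proof -
  have "avg m (\<lambda>u. avg n (\<lambda>v. 0)) \<le> mlcs m n"
    unfolding mean_lcs_eq_avg by (intro avg_mono) auto
  then show ?thesis by simp
qed

lemma mlcs_commute: "mlcs m n = mlcs n m"
  unfolding mean_lcs_eq_avg by (subst avg_swap) (simp add: lcs_length_commute)

lemma mlcs_le_left: "mlcs m n \<le> real m"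
proof -
  have "mlcs m n \<le> avg m (\<lambda>u. avg n (\<lambda>v. real m))"
    unfolding mean_lcs_eq_avg
    by (intro avg_mono) (metis length_binary_words lcs_length_le_left of_nat_mono)
  then show ?thesis by simp
qed

lemma mlcs_superadditive: "mlcs m n + mlcs m' n' \<le> mlcs (m + m') (n + n')"
proof -
  have "mlcs m n + mlcs m' n' = avg m (\<lambda>u. avg m' (\<lambda>u'. avg n (\<lambda>v. avg n' (\<lambda>v'.
      real (lcs_length u v) + real (lcs_length u' v')))))"
    unfolding mean_lcs_eq_avg by (simp add: avg_add)
  also have "\<dots> \<le> avg m (\<lambda>u. avg m' (\<lambda>u'. avg n (\<lambda>v. avg n' (\<lambda>v'.
      real (lcs_length (u @ u') (v @ v'))))))"
    by (intro avg_mono) (metis lcs_length_append_ge of_nat_add of_nat_mono)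
  also have "\<dots> = mlcs (m + m') (n + n')"
    unfolding mean_lcs_eq_avg by (simp add: avg_append)
  finally show ?thesis .
qed

lemma mlcs_add_left_ge: "mlcs m n \<le> mlcs (m + k) n"
  using mlcs_superadditive[of m n k 0] mlcs_nonneg[of k 0] by simp

lemma lcs_length_append_le: "lcs_length (xs @ xs') ys \<le> lcs_length xs ys + length xs'"
proof -
  obtain i where "lcs_length (xs @ xs') ys = lcs_length xs (take i ys) + lcs_length xs' (drop i ys)"
    by (rule lcs_length_append_split)
  moreover have "lcs_length xs (take i ys) \<le> lcs_length xs ys"
    by (intro lcs_length_mono) auto
  ultimately show ?thesis using lcs_length_le_left[of xs' "drop i ys"] by simp
qed

lemma mlcs_add_left_le: "mlcs (m + k) n \<le> mlcs m n + real k"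
proof -
  have "mlcs (m + k) n \<le> avg m (\<lambda>u. avg k (\<lambda>u'. avg n (\<lambda>v. real (lcs_length u v) + real k)))"
    unfolding mean_lcs_eq_avg avg_append
    by (intro avg_mono) (metis lcs_length_append_le length_binary_words of_nat_add of_nat_mono)
  then show ?thesis by (simp add: avg_add mean_lcs_eq_avg)
qed

lemma mlcs_left_lipschitz: "mlcs m n \<le> mlcs m' n + \<bar>real m - real m'\<bar>"
proof (cases "m \<le> m'")
  case True
  then show ?thesis using mlcs_add_left_ge[of m n "m' - m"] by simp
next
  case False
  then show ?thesis using mlcs_add_left_le[of m' "m - m'" n] by simp
qed

lemma mlcs_lipschitz: "mlcs m n \<le> mlcs m' n' + \<bar>real m - real m'\<bar> + \<bar>real n - real n'\<bar>"
  using mlcs_left_lipschitz[of m n m'] mlcs_left_lipschitz[of n m' n'] mlcs_commute[of m' n]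
    mlcs_commute[of m' n'] by linarith

lemma mlcs_right_mono: "n \<le> n' \<Longrightarrow> mlcs m n \<le> mlcs m n'"
  using mlcs_add_left_ge[of n m "n' - n"] mlcs_commute[of m n] mlcs_commute[of m n'] by simp

lemma mlcs_left_mono: "m \<le> m' \<Longrightarrow> mlcs m n \<le> mlcs m' n"
  using mlcs_right_mono[of m m' n] by (simp add: mlcs_commute)

text \<open>The Monge inequality with single uniform letters for \<open>y1\<close> and
  \<open>y3\<close>: then \<open>a @ w\<close> and \<open>w @ b\<close> are both uniform of length
  \<open>n + 1\<close>.\<close>

lemma mlcs_concave: "mlcs m (n + 2) + mlcs m n \<le> 2 * mlcs m (n + 1)"
proof -
  have split: "mlcs m (1 + (n + 1)) = avg m (\<lambda>x. avg 1 (\<lambda>a. avg n (\<lambda>w. avg 1 (\<lambda>b.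
        real (lcs_length x (a @ w @ b))))))"
    unfolding mean_lcs_eq_avg avg_append ..
  have left: "mlcs m (1 + n) = avg m (\<lambda>x. avg 1 (\<lambda>a. avg n (\<lambda>w. avg 1 (\<lambda>b.
        real (lcs_length x (a @ w))))))"
    unfolding mean_lcs_eq_avg avg_append by simp
  have right: "mlcs m (n + 1) = avg m (\<lambda>x. avg 1 (\<lambda>a. avg n (\<lambda>w. avg 1 (\<lambda>b.
        real (lcs_length x (w @ b))))))"
    unfolding mean_lcs_eq_avg avg_append avg_const ..
  have mid: "mlcs m n = avg m (\<lambda>x. avg 1 (\<lambda>a. avg n (\<lambda>w. avg 1 (\<lambda>b. real (lcs_length x w)))))"
    unfolding mean_lcs_eq_avg avg_const ..
  have "mlcs m (1 + (n + 1)) + mlcs m n \<le> mlcs m (1 + n) + mlcs m (n + 1)"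
    unfolding split left right mid avg_add[symmetric]
    by (intro avg_mono) (metis lcs_length_Monge of_nat_add of_nat_mono)
  then show ?thesis by (simp add: add.commute)
qed

lemma concave_increment_antimono:
  fixes g :: "nat \<Rightarrow> real"
  assumes "\<And>n. g (n + 2) + g n \<le> 2 * g (n + 1)" "a \<le> b"
  shows "g (b + k) - g b \<le> g (a + k) - g a"
proof -
  have step: "g (Suc b) - g b \<le> g (Suc a) - g a" if "a \<le> b" for a b
    using that
  proof (induction rule: dec_induct)
    case (step n)
    then show ?case using assms(1)[of n] by simp
  qed simp
  show ?thesis
  proof (induction k)
    case (Suc k)
    then show ?case using step[of "a + k" "b + k"] assms(2) by simp
  qed simp
qed

text \<open>For \<open>i \<le> n\<close> the windows from \<open>i\<close> to \<open>n\<close> and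
  from \<open>n\<close> to \<open>2 * n - i\<close> are equally long, and by concavity the increment
  over the later one is no larger.\<close>

lemma mlcs_balanced:
  assumes "i \<le> 2 * n" shows "mlcs n i + mlcs n (2 * n - i) \<le> 2 * mlcs n n"
proof -
  have *: "mlcs n i + mlcs n (2 * n - i) \<le> 2 * mlcs n n" if "i \<le> n" for i
  proof -
    have "2 * n - i = n + (n - i)" "i + (n - i) = n" using that by auto
    then show ?thesis
      using concave_increment_antimono[where g = "mlcs n" and k = "n - i", OF mlcs_concave that]
      unfolding \<open>2 * n - i = n + (n - i)\<close> \<open>i + (n - i) = n\<close> by linarith
  qed
  show ?thesis
  proof (cases "i \<le> n")
    case False
    then have "2 * n - i \<le> n" "2 * n - (2 * n - i) = i" using assms by auto
    then show ?thesis using *[of "2 * n - i"] by simp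
  qed (rule *)
qed

text \<open>By concavity the unit increment at \<open>n\<close> is at most the average increment
  from \<open>a\<close> to \<open>b\<close> and at least every later one.\<close>

lemma concave_slope_le:
  fixes g :: "nat \<Rightarrow> real"
  assumes "\<And>n. g (n + 2) + g n \<le> 2 * g (n + 1)" "a < b" "b \<le> n"
  shows "g (n + k) - g n \<le> real k * ((g b - g a) / (real b - real a))"
proof -
  let ?D = "g (n + 1) - g n"
  have "real j * ?D \<le> g (a + j) - g a" if "a + j \<le> b" for j
    using that
  proof (induction j)
    case (Suc j)
    then show ?case
      using concave_increment_antimono[of g "a + j" n 1] assms by (simp add: algebra_simps)
  qed simp
  from this[of "b - a"] have "?D \<le> (g b - g a) / (real b - real a)"
    using assms(2) by (simp add: field_simps)
  moreover have "g (n + k) - g n \<le> real k * ?D"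
  proof (induction k)
    case (Suc k)
    then show ?case
      using concave_increment_antimono[of g n "n + k" 1] assms by (simp add: algebra_simps)
  qed simp
  ultimately show ?thesis
    by (meson mult_left_mono of_nat_0_le_iff order_trans)
qed

text \<open>Fekete's lemma, by division with remainder by some \<open>k\<close> whose quotient is
  close to the supremum.\<close>

lemma superadditive_limit:
  fixes b :: "nat \<Rightarrow> real"
  assumes super: "\<And>m n. m \<ge> 1 \<Longrightarrow> n \<ge> 1 \<Longrightarrow> b m + b n \<le> b (m + n)"
    and bound: "\<And>n. n \<ge> 1 \<Longrightarrow> b n \<le> K * real n"
  obtains L where "(\<lambda>n. b n / real n) \<longlonglongrightarrow> L" "\<And>n. n \<ge> 1 \<Longrightarrow> b n \<le> L * real n"
proof -
  define L where "L = (SUP n\<in>{1..}. b n / real n)"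
  have bdd: "bdd_above ((\<lambda>n. b n / real n) ` {1..})"
    using bound by (intro bdd_aboveI[of _ K]) (auto simp: divide_le_eq)
  have le: "b n / real n \<le> L" if "n \<ge> 1" for n
    unfolding L_def using that bdd by (intro cSUP_upper) auto
  have mult: "real q * b k \<le> b (q * k)" if "q \<ge> 1" "k \<ge> 1" for q k
    using that(1)
  proof (induction q rule: dec_induct)
    case (step q)
    then show ?case
      using super[of "q * k" k] that(2) by (simp add: algebra_simps)
  qed simp
  have "(\<lambda>n. b n / real n) \<longlonglongrightarrow> L"
  proof (rule LIMSEQ_I)
    fix e :: real assume e: "e > 0"
    then obtain k where k: "k \<ge> 1" "b k / real k > L - e / 2"
      using less_cSUP_iff[of "{1..}" "\<lambda>n. b n / real n" "L - e / 2"] bdd by (auto simp: L_def)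
    \<comment> \<open>\<open>C\<close> bounds the loss caused by the remainder \<open>r\<close> of
      the division by \<open>k\<close>, uniformly in \<open>n\<close>.\<close>
    define C where "C = \<bar>b k\<bar> + (\<Sum>r<k. \<bar>b r\<bar>) + 1"
    have C: "C > 0" unfolding C_def by (smt (verit) sum_nonneg)
    have lower: "b n \<ge> real n * (L - e / 2) - C" if "n \<ge> k" for n
    proof -
      define q r where "q = n div k" and "r = n mod k"
      have n: "n = q * k + r" "q \<ge> 1" "r < k"
        using k that by (auto simp: q_def r_def div_greater_zero_iff Suc_le_eq)
      have r: "\<bar>b r\<bar> \<le> (\<Sum>r<k. \<bar>b r\<bar>)"
        using n by (intro member_le_sum) auto
      have "real q * b k - \<bar>b r\<bar> \<le> b n"
      proof (cases "r = 0")
        case True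
        then show ?thesis using mult[of q k] n k by simp
      next
        case False
        then have "b (q * k) + b r \<le> b (q * k + r)"
          using n k by (intro super) auto
        then show ?thesis using mult[of q k] n k by simp
      qed
      moreover have "real n * (b k / real k) - \<bar>b k\<bar> \<le> real q * b k"
      proof -
        have "real n * (b k / real k) = real q * b k + real r / real k * b k"
          using n k by (simp add: field_simps)
        moreover have "real r / real k * b k \<le> real r / real k * \<bar>b k\<bar>"
          by (intro mult_left_mono) auto
        moreover have "real r / real k * \<bar>b k\<bar> \<le> 1 * \<bar>b k\<bar>"
          using n k by (intro mult_right_mono) auto
        ultimately show ?thesis by simp
      qed
      moreover have "real n * (L - e / 2) \<le> real n * (b k / real k)"
        using k by (intro mult_left_mono) auto
      ultimately show ?thesis using r unfolding C_def by linarith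
    qed
    obtain N where N: "real N > 2 * C / e" using reals_Archimedean2 by blast
    show "\<exists>no. \<forall>n\<ge>no. norm (b n / real n - L) < e"
    proof (intro exI[of _ "max (max N k) 1"] allI impI)
      fix n assume n: "n \<ge> max (max N k) 1"
      have "2 * C / e < real n" using N n by linarith
      then have "C < e / 2 * real n" using e by (simp add: field_simps)
      then have "b n > real n * (L - e)" using lower[of n] n by (simp add: algebra_simps)
      then have "b n / real n > L - e" using n by (simp add: field_simps)
      then show "norm (b n / real n - L) < e" using le[of n] n e by auto
    qed
  qed
  then show ?thesis
    using that le by (simp add: divide_le_eq)
qed

section \<open>Existence and first bounds of the mean LCS function\<close>

lemma round_pos_ge: "round_pos x \<ge> 1"
  by (simp add: round_pos_def)

lemma round_pos_close: assumes "x > 0" shows "\<bar>real (round_pos x) - x\<bar> \<le> 1"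
proof -
  have r: "\<bar>real_of_int (round x) - x\<bar> \<le> 1 / 2" by (rule of_int_round_abs_le)
  show ?thesis
  proof (cases "round x \<ge> 1")
    case True
    then have "real (round_pos x) = real_of_int (round x)" by (simp add: round_pos_def max_def)
    then show ?thesis using r by linarith
  next
    case False
    then have "round_pos x = 1" "round x \<le> 0" by (auto simp: round_pos_def max_def)
    then have "x \<le> 1 / 2" using r by linarith
    then show ?thesis using \<open>round_pos x = 1\<close> assms by auto
  qed
qed

lemma round_pos_of_nat [simp]: "n \<ge> 1 \<Longrightarrow> round_pos (real n) = n"
  by (simp add: round_pos_def)

lemma gamma_star_limit: "(\<lambda>n. mlcs n n / real n) \<longlonglongrightarrow> gamma_star 2"
  and mlcs_diag_le: "mlcs n n \<le> gamma_star 2 * real n"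
proof -
  obtain L where L: "(\<lambda>n. mlcs n n / real n) \<longlonglongrightarrow> L" "\<And>n. n \<ge> 1 \<Longrightarrow> mlcs n n \<le> L * real n"
    by (rule superadditive_limit[of "\<lambda>n. mlcs n n" 1])
      (use mlcs_superadditive mlcs_le_left in auto)
  have "gamma_star 2 = L" unfolding gamma_star_def using L(1) by (rule limI)
  then show "(\<lambda>n. mlcs n n / real n) \<longlonglongrightarrow> gamma_star 2" "mlcs n n \<le> gamma_star 2 * real n"
    using L mlcs_le_left[of 0 0] by (cases "n = 0"; auto)+
qed

text \<open>Juxtaposing the lengths \<open>(m, n)\<close> and \<open>(n, m)\<close> gives a pair on
  the diagonal, where \<open>mlcs_diag_le\<close> applies.\<close>

lemma mlcs_le: "mlcs m n \<le> gamma_star 2 * real (m + n) / 2"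
  using mlcs_superadditive[of m n n m] mlcs_diag_le[of "m + n"] mlcs_commute[of m n]
  by (simp add: add.commute)

lemma scaled_lengths_pos:
  assumes "\<bar>p\<bar> < 1" "n \<ge> 1"
  shows "real n - real n * p > 0" "real n + real n * p > 0"
proof -
  have "real n * \<bar>p\<bar> < real n * 1" using assms by (intro mult_strict_left_mono) auto
  then have "\<bar>real n * p\<bar> < real n" by (simp add: abs_mult)
  then show "real n - real n * p > 0" "real n + real n * p > 0" by linarith+
qed

lemma gamma_n_limit:
  assumes "\<bar>p\<bar> < 1"
  shows "(\<lambda>n. gamma_n 2 n p) \<longlonglongrightarrow> gamma 2 p"
proof -
  define x y where "x n = round_pos (real n - real n * p)" and "y n = round_pos (real n + real n * p)" for n
  have pos: "real n - real n * p > 0" "real n + real n * p > 0" if "n \<ge> 1" for n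
    using scaled_lengths_pos[OF assms that] by auto
  have x: "\<bar>real (x n) - (real n - real n * p)\<bar> \<le> 1" and y: "\<bar>real (y n) - (real n + real n * p)\<bar> \<le> 1"
    if "n \<ge> 1" for n
    using round_pos_close pos[OF that] unfolding x_def y_def by auto
  \<comment> \<open>Three roundings change each of the two lengths by at most 3, so superadditivity
    fails by at most 6 and is restored by subtracting 6.\<close>
  have add: "mlcs (x m) (y m) + mlcs (x n) (y n) \<le> mlcs (x (m + n)) (y (m + n)) + 6"
    if "m \<ge> 1" "n \<ge> 1" for m n
  proof -
    have "\<bar>real (x m + x n) - real (x (m + n))\<bar> \<le> 3" "\<bar>real (y m + y n) - real (y (m + n))\<bar> \<le> 3"
      using x[of m] x[of n] x[of "m + n"] y[of m] y[of n] y[of "m + n"] that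
      by (auto simp: algebra_simps abs_le_iff)
    then show ?thesis
      using mlcs_superadditive[of "x m" "y m" "x n" "y n"]
        mlcs_lipschitz[of "x m + x n" "y m + y n" "x (m + n)" "y (m + n)"] by linarith
  qed
  have "mlcs (x n) (y n) \<le> 3 * real n" if "n \<ge> 1" for n
  proof -
    have "real n * \<bar>p\<bar> \<le> real n * 1" using assms by (intro mult_left_mono) auto
    then have "\<bar>real n * p\<bar> \<le> real n" by (simp add: abs_mult)
    then show ?thesis using mlcs_le_left[of "x n" "y n"] x[OF that] that by linarith
  qed
  then obtain L where L: "(\<lambda>n. (mlcs (x n) (y n) - 6) / real n) \<longlonglongrightarrow> L"
    using superadditive_limit[of "\<lambda>n. mlcs (x n) (y n) - 6" 3] add by (smt (verit))
  have "(\<lambda>n. (mlcs (x n) (y n) - 6) / real n + 6 / real n) \<longlonglongrightarrow> L + 0"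
    by (intro tendsto_add L lim_const_over_n)
  then have "(\<lambda>n. gamma_n 2 n p) \<longlonglongrightarrow> L"
    by (simp add: gamma_n_def x_def y_def diff_divide_distrib)
  then show ?thesis unfolding gamma_def by (metis limI)
qed

lemma gamma_n_zero: "n \<ge> 1 \<Longrightarrow> gamma_n 2 n 0 = mlcs n n / real n"
  by (simp add: gamma_n_def)

lemma gamma_zero: "gamma 2 0 = gamma_star 2"
proof -
  have "(\<lambda>n. gamma_n 2 n 0) \<longlonglongrightarrow> gamma_star 2"
    by (rule Lim_transform_eventually[OF gamma_star_limit])
      (auto intro!: eventually_sequentiallyI[of 1] simp: gamma_n_zero)
  then show ?thesis using gamma_n_limit[of 0] LIMSEQ_unique by auto
qed

lemma gamma_minus: "gamma 2 (- p) = gamma 2 p"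
  by (simp add: gamma_def gamma_n_def mlcs_commute)

text \<open>For every \<open>p\<close> the two lengths add up to \<open>2 * n\<close>, apart from
  rounding, so \<open>mlcs_le\<close> applies. Together with \<open>gamma_zero\<close> this makes 0
  a maximum point.\<close>

lemma gamma_le:
  assumes "\<bar>p\<bar> < 1" shows "gamma 2 p \<le> gamma_star 2"
proof -
  have g0: "gamma_star 2 \<ge> 0" using mlcs_diag_le[of 1] mlcs_nonneg[of 1 1] by simp
  have "gamma_n 2 n p \<le> gamma_star 2 + gamma_star 2 / real n" if n: "n \<ge> 1" for n
  proof -
    have pos: "real n - real n * p > 0" "real n + real n * p > 0"
      using scaled_lengths_pos[OF assms n] by auto
    have "real (round_pos (real n - real n * p)) + real (round_pos (real n + real n * p)) \<le> 2 * real n + 2"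
      using round_pos_close[OF pos(1)] round_pos_close[OF pos(2)] by linarith
    then have "gamma_star 2 * real (round_pos (real n - real n * p) + round_pos (real n + real n * p)) / 2
        \<le> gamma_star 2 * (2 * real n + 2) / 2"
      using g0 by (intro divide_right_mono mult_left_mono) auto
    then have "mlcs (round_pos (real n - real n * p)) (round_pos (real n + real n * p)) \<le> gamma_star 2 * (real n + 1)"
      using mlcs_le[of "round_pos (real n - real n * p)" "round_pos (real n + real n * p)"] by (simp add: algebra_simps)
    then show ?thesis using n unfolding gamma_n_def by (simp add: field_simps)
  qed
  moreover have "(\<lambda>n. gamma_star 2 + gamma_star 2 / real n) \<longlonglongrightarrow> gamma_star 2 + 0"
    by (intro tendsto_intros lim_const_over_n)
  ultimately have "gamma 2 p \<le> gamma_star 2 + 0"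
    by (intro LIMSEQ_le[OF gamma_n_limit[OF assms]]) (auto intro: exI[of _ 1])
  then show ?thesis by simp
qed

subsection \<open>Concentration and rate of convergence\<close>

lemma avg_word_lipschitz:
  assumes "\<And>v. word_lipschitz (\<lambda>u. H u v)"
  shows "word_lipschitz (\<lambda>u. avg n (H u))"
  unfolding word_lipschitz_def
proof (intro allI)
  fix p q a b
  have "avg n (\<lambda>v. H (p @ x # q) v - H (p @ y # q) v) \<le> avg n (\<lambda>_. 1)" for x y
    using assms unfolding word_lipschitz_def by (intro avg_mono) (metis abs_le_D1)
  from this[of a b] this[of b a] show "\<bar>avg n (H (p @ a # q)) - avg n (H (p @ b # q))\<bar> \<le> 1"
    by (simp add: avg_diff)
qed

lemma avg_avg_exp_le:
  assumes "\<And>v. word_lipschitz (\<lambda>u. H u v)" "\<And>u. word_lipschitz (H u)"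
  shows "avg m (\<lambda>u. avg n (\<lambda>v. exp (s * H u v)))
    \<le> exp (s * avg m (\<lambda>u. avg n (H u)) + s\<^sup>2 * real (m + n) / 8)"
proof -
  have "avg m (\<lambda>u. avg n (\<lambda>v. exp (s * H u v)))
      \<le> avg m (\<lambda>u. exp (s\<^sup>2 * real n / 8) * exp (s * avg n (H u)))"
    using avg_exp_le[OF assms(2)] by (intro avg_mono) (simp add: add.commute flip: exp_add)
  also have "\<dots> \<le> exp (s\<^sup>2 * real n / 8) * exp (s * avg m (\<lambda>u. avg n (H u)) + s\<^sup>2 * real m / 8)"
    unfolding avg_cmult
    by (intro mult_left_mono avg_exp_le avg_word_lipschitz assms) auto
  also have "\<dots> = exp (s * avg m (\<lambda>u. avg n (H u)) + s\<^sup>2 * real (m + n) / 8)"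
    by (simp add: algebra_simps add_divide_distrib flip: exp_add)
  finally show ?thesis .
qed

lemma avg_avg_tail:
  assumes "\<And>v. word_lipschitz (\<lambda>u. H u v)" "\<And>u. word_lipschitz (H u)" "t \<ge> 0"
  shows "avg m (\<lambda>u. avg n (\<lambda>v. of_bool (H u v \<ge> avg m (\<lambda>u. avg n (H u)) + t)))
    \<le> exp (- 2 * t\<^sup>2 / real (m + n))"
proof -
  define \<mu> where "\<mu> = avg m (\<lambda>u. avg n (H u))"
  \<comment> \<open>This \<open>s\<close> minimises
    \<open>s\<^sup>2 * real (m + n) / 8 - s * t\<close>. For \<open>m + n = 0\<close> division by
    zero gives \<open>s = 0\<close> and the bound 1.\<close>
  define s where "s = 4 * t / real (m + n)"
  have s: "s \<ge> 0" using assms by (simp add: s_def)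
  have "avg m (\<lambda>u. avg n (\<lambda>v. of_bool (H u v \<ge> \<mu> + t)))
      \<le> avg m (\<lambda>u. avg n (\<lambda>v. exp (- s * (\<mu> + t)) * exp (s * H u v)))"
  proof (intro avg_mono)
    fix u v
    show "of_bool (H u v \<ge> \<mu> + t) \<le> exp (- s * (\<mu> + t)) * exp (s * H u v)"
      using mult_left_mono[of "\<mu> + t" "H u v" s] s by (auto simp flip: exp_add)
  qed
  also have "\<dots> \<le> exp (- s * (\<mu> + t)) * exp (s * \<mu> + s\<^sup>2 * real (m + n) / 8)"
    unfolding avg_cmult \<mu>_def by (intro mult_left_mono avg_avg_exp_le assms) auto
  also have "\<dots> = exp (s\<^sup>2 * real (m + n) / 8 - s * t)"
    by (simp add: algebra_simps flip: exp_add)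
  also have "s\<^sup>2 * real (m + n) / 8 - s * t = - 2 * t\<^sup>2 / real (m + n)"
    by (cases "m + n = 0") (auto simp: s_def field_simps power2_eq_square simp del: of_nat_add)
  finally show ?thesis by (simp add: \<mu>_def)
qed

lemma word_lipschitz_lcs:
  "word_lipschitz (\<lambda>u. real (lcs_length u v))" "word_lipschitz (\<lambda>v. real (lcs_length u v))"
  unfolding word_lipschitz_def using lcs_length_subst_left lcs_length_subst_right by auto

text \<open>A letter lies in only one of the two parts, so the constant remains 1.\<close>

lemma word_lipschitz_take_drop:
  assumes "word_lipschitz F" "word_lipschitz G"
  shows "word_lipschitz (\<lambda>v. F (take i v) + G (drop i v))"
  unfolding word_lipschitz_def
proof (intro allI)
  fix p q a b
  show "\<bar>F (take i (p @ a # q)) + G (drop i (p @ a # q)) - (F (take i (p @ b # q)) + G (drop i (p @ b # q)))\<bar> \<le> 1"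
  proof (cases "length p < i")
    case True
    then obtain k where "i - length p = Suc k" by (metis Suc_pred zero_less_diff)
    then show ?thesis using True assms(1) by (simp add: word_lipschitz_def)
  next
    case False
    then show ?thesis using assms(2) by (simp add: word_lipschitz_def)
  qed
qed

lemma word_lipschitz_const: "word_lipschitz (\<lambda>_. c)"
  by (simp add: word_lipschitz_def)

lemma word_lipschitz_add_const: "word_lipschitz F \<Longrightarrow> word_lipschitz (\<lambda>w. F w + c)"
  by (simp add: word_lipschitz_def)

text \<open>Jensen's inequality, from the tangent of \<open>exp\<close> at the mean.\<close>

lemma exp_avg_le: "exp (avg n F) \<le> avg n (\<lambda>w. exp (F w))"
proof -
  have "avg n (\<lambda>w. exp (avg n F) * (1 + (F w - avg n F))) \<le> avg n (\<lambda>w. exp (F w))"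
  proof (rule avg_mono)
    fix w
    have "exp (avg n F) * (1 + (F w - avg n F)) \<le> exp (avg n F) * exp (F w - avg n F)"
      by (intro mult_left_mono exp_ge_add_one_self) auto
    then show "exp (avg n F) * (1 + (F w - avg n F)) \<le> exp (F w)"
      by (simp flip: exp_add)
  qed
  then show ?thesis by (simp add: avg_cmult avg_add avg_diff)
qed

text \<open>An alignment of words of length \<open>2 * n\<close> splits at the middle of the first word. Each of the
  \<open>2 * n + 1\<close> possible splittings has mean at most \<open>2 * mlcs n n\<close> by concavity, and subgaussian
  fluctuations.\<close>

lemma mlcs_double_le:
  assumes "n \<ge> 1"
  shows "mlcs (2 * n) (2 * n) \<le> 2 * mlcs n n + sqrt (real n) * (ln (2 * real n + 1) + 1 / 2)"
proof -
  \<comment> \<open>With this \<open>s\<close> the \<open>4 * n\<close> letters of \<open>x\<close>,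
    \<open>x'\<close> and \<open>y\<close> contribute \<open>s\<^sup>2 * (4 * n) / 8 = 1 / 2\<close>
    to the exponent.\<close>
  define s where "s = 1 / sqrt (real n)"
  have s: "s > 0" "s\<^sup>2 = 1 / real n" using assms by (auto simp: s_def power_divide)
  define Z where "Z i x x' y = real (lcs_length x (take i y)) + real (lcs_length x' (drop i y))"
    for i and x x' y :: "nat list"
  have Z: "avg n (\<lambda>x. avg n (\<lambda>x'. avg (2 * n) (\<lambda>y. exp (s * Z i x x' y))))
      \<le> exp (s * (2 * mlcs n n) + 1 / 2)" if i: "i \<le> 2 * n" for i
  proof -
    have lip: "word_lipschitz (\<lambda>x. Z i x x' y)" "word_lipschitz (\<lambda>x'. Z i x x' y)" "word_lipschitz (Z i x x')" for x x' y
      unfolding Z_def using word_lipschitz_add_const[OF word_lipschitz_lcs(1), of "take i y" "real (lcs_length x' (drop i y))"]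
        word_lipschitz_add_const[OF word_lipschitz_lcs(1), of "drop i y" "real (lcs_length x (take i y))"]
        word_lipschitz_take_drop[OF word_lipschitz_lcs(2) word_lipschitz_lcs(2), of x i x']
      by (simp_all add: add.commute)
    have mean: "avg n (\<lambda>x. avg n (\<lambda>x'. avg (2 * n) (Z i x x'))) = mlcs n i + mlcs n (2 * n - i)"
    proof -
      have "avg (2 * n) (Z i x x') = avg i (\<lambda>y. real (lcs_length x y)) + avg (2 * n - i) (\<lambda>y. real (lcs_length x' y))" for x x'
        unfolding Z_def avg_add
        using avg_take[OF i, of "\<lambda>y. real (lcs_length x y)"] avg_drop[OF i, of "\<lambda>y. real (lcs_length x' y)"] by simp
      then show ?thesis unfolding mean_lcs_eq_avg by (simp add: avg_add)
    qed
    have "avg n (\<lambda>x. avg n (\<lambda>x'. avg (2 * n) (\<lambda>y. exp (s * Z i x x' y))))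
        \<le> avg n (\<lambda>x. exp (s\<^sup>2 * real (n + 2 * n) / 8) * exp (s * avg n (\<lambda>x'. avg (2 * n) (Z i x x'))))"
    proof (rule avg_mono)
      fix x
      show "avg n (\<lambda>x'. avg (2 * n) (\<lambda>y. exp (s * Z i x x' y)))
          \<le> exp (s\<^sup>2 * real (n + 2 * n) / 8) * exp (s * avg n (\<lambda>x'. avg (2 * n) (Z i x x')))"
        using avg_avg_exp_le[OF lip(2,3), of n "2 * n" s x] unfolding exp_add by (simp only: mult.commute)
    qed
    also have "\<dots> \<le> exp (s\<^sup>2 * real (n + 2 * n) / 8) * exp (s * (mlcs n i + mlcs n (2 * n - i)) + s\<^sup>2 * real n / 8)"
      unfolding avg_cmult mean[symmetric]
      by (intro mult_left_mono avg_exp_le avg_word_lipschitz lip) auto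
    also have "\<dots> \<le> exp (s * (2 * mlcs n n) + 1 / 2)"
      using mult_left_mono[OF mlcs_balanced[OF i], of s] s assms
      by (auto simp: field_simps simp flip: exp_add)
    finally show ?thesis .
  qed
  have "exp (s * mlcs (2 * n) (2 * n))
      = exp (avg (n + n) (\<lambda>x. avg (2 * n) (\<lambda>y. s * real (lcs_length x y))))"
    by (simp add: mean_lcs_eq_avg avg_cmult mult_2)
  also have "\<dots> \<le> avg (n + n) (\<lambda>x. exp (avg (2 * n) (\<lambda>y. s * real (lcs_length x y))))"
    by (rule exp_avg_le)
  also have "\<dots> \<le> avg (n + n) (\<lambda>x. avg (2 * n) (\<lambda>y. exp (s * real (lcs_length x y))))"
    by (intro avg_mono exp_avg_le)
  also have "\<dots> = avg n (\<lambda>x. avg n (\<lambda>x'. avg (2 * n) (\<lambda>y. exp (s * real (lcs_length (x @ x') y)))))"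
    by (rule avg_append)
  \<comment> \<open>The best splitting is bounded by the sum over all \<open>2 * n + 1\<close> of
    them; this is the source of the logarithm.\<close>
  also have "\<dots> \<le> avg n (\<lambda>x. avg n (\<lambda>x'. avg (2 * n) (\<lambda>y. \<Sum>i\<le>2 * n. exp (s * Z i x x' y))))"
  proof (intro avg_mono)
    fix x x' y assume "y \<in> binary_words (2 * n)"
    then obtain i where "i \<le> 2 * n" "lcs_length (x @ x') y = lcs_length x (take i y) + lcs_length x' (drop i y)"
      using lcs_length_append_split[of y x x'] length_binary_words by metis
    then show "exp (s * real (lcs_length (x @ x') y)) \<le> (\<Sum>i\<le>2 * n. exp (s * Z i x x' y))"
      using member_le_sum[of i "{..2 * n}" "\<lambda>i. exp (s * Z i x x' y)"] by (simp add: Z_def)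
  qed
  also have "\<dots> = (\<Sum>i\<le>2 * n. avg n (\<lambda>x. avg n (\<lambda>x'. avg (2 * n) (\<lambda>y. exp (s * Z i x x' y)))))"
    by (simp add: avg_sum)
  also have "\<dots> \<le> (\<Sum>i\<le>2 * n. exp (s * (2 * mlcs n n) + 1 / 2))"
    using Z by (intro sum_mono) auto
  also have "\<dots> = exp (ln (2 * real n + 1) + (s * (2 * mlcs n n) + 1 / 2))"
    by (simp add: exp_add add.commute)
  finally have "s * mlcs (2 * n) (2 * n) \<le> ln (2 * real n + 1) + (s * (2 * mlcs n n) + 1 / 2)"
    by simp
  then have "sqrt (real n) * (s * mlcs (2 * n) (2 * n))
      \<le> sqrt (real n) * (ln (2 * real n + 1) + (s * (2 * mlcs n n) + 1 / 2))"
    by (intro mult_left_mono) auto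
  moreover have "sqrt (real n) * (s * x) = x" for x using assms by (simp add: s_def)
  ultimately show ?thesis by (simp add: distrib_left)
qed

text \<open>Passing from \<open>n\<close> to \<open>2 * n\<close> costs at most
  \<open>B * n powr \<theta>\<close>, as \<open>\<theta> > 1 / 2\<close> absorbs the logarithm. Per
  letter, the costs of repeated doubling form a geometric series because
  \<open>\<theta> < 1\<close>.\<close>

lemma mlcs_rate:
  assumes "1 / 2 < \<theta>" "\<theta> < 1"
  obtains C where "C > 0" "\<And>n. n \<ge> 1 \<Longrightarrow> gamma_star 2 * real n - C * real n powr \<theta> \<le> mlcs n n"
proof -
  define e where "e = \<theta> - 1 / 2"
  have e: "e > 0" using assms by (simp add: e_def)
  define B where "B = 3 powr e / e + 1 / 2"
  have B: "B > 0" using e by (simp add: B_def add_pos_pos)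
  have double: "mlcs (2 * n) (2 * n) \<le> 2 * mlcs n n + B * real n powr \<theta>" if n: "n \<ge> 1" for n
  proof -
    have "ln (2 * real n + 1) \<le> ln (3 * real n)" using n by simp
    also have "\<dots> \<le> (3 * real n) powr e / e" using n e by (intro ln_powr_bound) auto
    finally have "ln (2 * real n + 1) \<le> 3 powr e / e * real n powr e" using n by (simp add: powr_mult)
    moreover have "1 \<le> real n powr e" using n e by (intro ge_one_powr_ge_zero) auto
    ultimately have "ln (2 * real n + 1) + 1 / 2 \<le> B * real n powr e"
      by (simp add: B_def distrib_right)
    then have "sqrt (real n) * (ln (2 * real n + 1) + 1 / 2) \<le> sqrt (real n) * (B * real n powr e)"
      by (intro mult_left_mono) auto
    also have "\<dots> = B * real n powr \<theta>"
      using n by (simp add: e_def powr_half_sqrt[symmetric] flip: powr_add)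
    finally show ?thesis using mlcs_double_le[OF n] by linarith
  qed
  \<comment> \<open>Chosen so that the function \<open>h\<close> below satisfies
    \<open>h (2 * k) \<le> 2 * h k\<close>; then \<open>h n / n\<close> bounds the limit along
    \<open>2 ^ j * n\<close>.\<close>
  define C where "C = B / (2 - 2 powr \<theta>)"
  have p2: "2 powr \<theta> < 2" using assms powr_less_mono[of \<theta> 1 2] by simp
  have C: "C > 0" "B + C * 2 powr \<theta> = 2 * C" using B p2 by (auto simp: C_def field_simps)
  have "gamma_star 2 * real n \<le> mlcs n n + C * real n powr \<theta>" if n: "n \<ge> 1" for n
  proof -
    define h where "h k = mlcs k k + C * real k powr \<theta>" for k
    have h: "h (2 * k) \<le> 2 * h k" if "k \<ge> 1" for k
    proof -
      have "(B + C * 2 powr \<theta>) * real k powr \<theta> = 2 * C * real k powr \<theta>" by (simp add: C)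
      then show ?thesis using double[OF that] by (simp add: h_def powr_mult algebra_simps)
    qed
    have hk: "h (2 ^ j * n) \<le> 2 ^ j * h n" for j
    proof (induction j)
      case (Suc j)
      then show ?case using h[of "2 ^ j * n"] n by (simp add: mult.assoc)
    qed simp
    have "mlcs (2 ^ j * n) (2 ^ j * n) / real (2 ^ j * n) \<le> h n / real n" for j
    proof -
      have "mlcs (2 ^ j * n) (2 ^ j * n) \<le> h (2 ^ j * n)" using C by (simp add: h_def)
      then have "mlcs (2 ^ j * n) (2 ^ j * n) \<le> 2 ^ j * h n" using hk[of j] by linarith
      then show ?thesis using n by (simp add: field_simps)
    qed
    moreover have "(\<lambda>j. mlcs (2 ^ j * n) (2 ^ j * n) / real (2 ^ j * n)) \<longlonglongrightarrow> gamma_star 2"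
      using LIMSEQ_subseq_LIMSEQ[OF gamma_star_limit, of "\<lambda>j. 2 ^ j * n"] n
      by (simp add: strict_mono_def o_def)
    ultimately have "gamma_star 2 \<le> h n / real n"
      using LIMSEQ_le_const2 by blast
    then show ?thesis using n by (simp add: h_def field_simps)
  qed
  then show ?thesis using that[of C] C by (simp add: algebra_simps)
qed

section \<open>Upper bound for the diagonal constant\<close>

lemma avg_mult_const: "avg n (\<lambda>w. F w * c) = avg n F * c"
  using avg_cmult[of n c F] by (simp add: mult.commute)

text \<open>An exponential bound with weight 8 for each letter of \<open>z\<close>: a letter of
  \<open>u\<close> is matched to the head of \<open>z\<close> with probability at most
  \<open>1 / 2\<close>, which gives the factor \<open>(8 + 1) / 2\<close>.\<close>

lemma avg_subseq_le: "avg n (\<lambda>u. of_bool (subseq z u)) \<le> (9 / 2) ^ n / 8 ^ length z"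
proof (induction n arbitrary: z)
  case 0
  then show ?case by (cases z) auto
next
  case (Suc n)
  show ?case
  proof (cases z)
    case Nil
    have "1 \<le> (9 / 2 :: real) ^ Suc n" by (rule one_le_power) simp
    then show ?thesis using Nil by simp
  next
    case (Cons a z')
    have *: "avg n (\<lambda>u. of_bool (subseq z (b # u))) \<le>
        (if a = b then (9 / 2) ^ n / 8 ^ length z' else (9 / 2) ^ n / 8 ^ length z)" for b
      using Suc.IH[of z'] Suc.IH[of z] Cons by auto
    have "avg (Suc n) (\<lambda>u. of_bool (subseq z u)) \<le> ((9 / 2) ^ n / 8 ^ length z' + (9 / 2) ^ n / 8 ^ length z) / 2"
    proof (cases "a = 0 \<or> a = 1")
      case True
      then have "avg n (\<lambda>u. of_bool (subseq z (0 # u))) + avg n (\<lambda>u. of_bool (subseq z (1 # u)))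
          \<le> (9 / 2) ^ n / 8 ^ length z' + (9 / 2) ^ n / 8 ^ length z"
      proof
        assume "a = 0"
        then show ?thesis
          using add_mono[OF *[of 0] *[of 1]] by (simp del: One_nat_def)
      next
        assume "a = 1"
        then show ?thesis
          using add_mono[OF *[of 1] *[of 0]] by (simp add: add.commute del: One_nat_def)
      qed
      then show ?thesis unfolding avg.simps by (rule divide_right_mono) simp
    next
      case False
      have "(9 / 2) ^ n / 8 ^ length z \<le> (9 / 2 :: real) ^ n / 8 ^ length z'"
        using Cons by (intro divide_left_mono) auto
      then have "avg n (\<lambda>u. of_bool (subseq z (0 # u))) + avg n (\<lambda>u. of_bool (subseq z (1 # u)))
          \<le> (9 / 2) ^ n / 8 ^ length z' + (9 / 2) ^ n / 8 ^ length z"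
        using add_mono[OF *[of 0] *[of 1]] False by (simp del: One_nat_def)
      then show ?thesis unfolding avg.simps by (rule divide_right_mono) simp
    qed
    also have "\<dots> = (9 / 2) ^ Suc n / 8 ^ length z"
      using Cons by (simp add: field_simps)
    finally show ?thesis .
  qed
qed

lemma subseq_exact_length:
  assumes "k \<le> lcs_length u v" "u \<in> binary_words n"
  obtains z where "z \<in> binary_words k" "subseq z u" "subseq z v"
proof -
  obtain z where z: "subseq z u" "subseq z v" "length z = lcs_length u v" by (rule lcs_lengthE)
  have "subseq (take k z) z" by auto
  then have "subseq (take k z) u" "subseq (take k z) v"
    using z subseq_order.order_trans by blast+
  moreover have "take k z \<in> binary_words k"
  proof -
    have "set (take k z) \<subseteq> set u"
      using list_emb_set[OF \<open>subseq (take k z) u\<close>] by blast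
    then show ?thesis using assms z(3) by (auto simp: binary_words_def)
  qed
  ultimately show ?thesis using that by blast
qed

text \<open>First moment method: among the \<open>2 ^ (8 * q)\<close> candidates of length
  \<open>8 * q\<close>, the expected number of common subsequences of two words of length
  \<open>9 * q\<close> is at most \<open>\<rho> ^ q\<close>, which tends to 0.\<close>

lemma gamma_star_le: "gamma_star 2 \<le> 8 / 9"
proof -
  define \<rho> :: real where "\<rho> = 2 ^ 8 * ((9 / 2) ^ 9 / 8 ^ 8)\<^sup>2"
  have \<rho>: "0 \<le> \<rho>" "\<rho> < 1" by (simp_all add: \<rho>_def power_divide)
  have le: "mlcs (9 * q) (9 * q) / real (9 * q) \<le> 8 / 9 + \<rho> ^ q" if q: "q \<ge> 1" for q
  proof -
    let ?n = "9 * q" and ?k = "8 * q"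
    have "mlcs ?n ?n \<le> avg ?n (\<lambda>u. avg ?n (\<lambda>v. real ?k + real ?n *
        (\<Sum>z\<in>binary_words ?k. of_bool (subseq z u) * of_bool (subseq z v))))"
      unfolding mean_lcs_eq_avg
    proof (intro avg_mono)
      fix u v assume u: "u \<in> binary_words ?n" and "v \<in> binary_words ?n"
      have S: "0 \<le> (\<Sum>z\<in>binary_words ?k. of_bool (subseq z u) * of_bool (subseq z v) :: real)"
        by (intro sum_nonneg) auto
      show "real (lcs_length u v) \<le> real ?k + real ?n *
          (\<Sum>z\<in>binary_words ?k. of_bool (subseq z u) * of_bool (subseq z v))"
      proof (cases "?k \<le> lcs_length u v")
        case True
        then obtain z where z: "z \<in> binary_words ?k" "subseq z u" "subseq z v"
          using u by (rule subseq_exact_length)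
        have "1 \<le> (\<Sum>z\<in>binary_words ?k. of_bool (subseq z u) * of_bool (subseq z v) :: real)"
          using member_le_sum[of z "binary_words ?k" "\<lambda>z. of_bool (subseq z u) * of_bool (subseq z v) :: real"] z
          by simp
        then have "real ?n * 1 \<le> real ?n * (\<Sum>z\<in>binary_words ?k. of_bool (subseq z u) * of_bool (subseq z v))"
          by (rule mult_left_mono) simp
        moreover have "real (lcs_length u v) \<le> real ?n"
          using lcs_length_le_left[of u v] length_binary_words[OF u] by simp
        ultimately show ?thesis by linarith
      next
        case False
        then have "real (lcs_length u v) \<le> real ?k" by linarith
        moreover have "0 \<le> real ?n * (\<Sum>z\<in>binary_words ?k. of_bool (subseq z u) * of_bool (subseq z v))"
          using S by (intro mult_nonneg_nonneg) auto
        ultimately show ?thesis by linarith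
      qed
    qed
    also have "\<dots> = real ?k + real ?n * (\<Sum>z\<in>binary_words ?k.
        avg ?n (\<lambda>u. of_bool (subseq z u)) * avg ?n (\<lambda>v. of_bool (subseq z v)))"
      by (simp only: avg_add avg_cmult avg_sum avg_mult_const avg_const)
    also have "\<dots> \<le> real ?k + real ?n * (\<Sum>z\<in>binary_words ?k. ((9 / 2) ^ ?n / 8 ^ ?k)\<^sup>2)"
    proof (intro add_left_mono mult_left_mono sum_mono)
      fix z assume "z \<in> binary_words ?k"
      then have "avg ?n (\<lambda>u. of_bool (subseq z u)) \<le> (9 / 2) ^ ?n / 8 ^ ?k"
        using avg_subseq_le[of ?n z] by (simp add: length_binary_words)
      moreover have "0 \<le> avg ?n (\<lambda>u. of_bool (subseq z u))"
        using avg_mono[of ?n "\<lambda>_. 0" "\<lambda>u. of_bool (subseq z u)"] by simp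
      ultimately show "avg ?n (\<lambda>u. of_bool (subseq z u)) * avg ?n (\<lambda>v. of_bool (subseq z v))
          \<le> ((9 / 2) ^ ?n / 8 ^ ?k)\<^sup>2"
        unfolding power2_eq_square by (intro mult_mono) auto
    qed simp
    also have "(\<Sum>z\<in>binary_words ?k. ((9 / 2) ^ ?n / 8 ^ ?k)\<^sup>2) = 2 ^ ?k * ((9 / 2) ^ ?n / 8 ^ ?k :: real)\<^sup>2"
      by (simp add: card_binary_words)
    also have "\<dots> = (2 ^ 8) ^ q * (((9 / 2) ^ 9) ^ q / (8 ^ 8) ^ q)\<^sup>2"
      by (simp only: power_mult)
    also have "\<dots> = \<rho> ^ q"
    proof -
      have "a ^ q * (b ^ q / c ^ q)\<^sup>2 = (a * (b / c)\<^sup>2) ^ q" for a b c :: real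
        by (simp add: power_mult_distrib power_divide power2_eq_square)
      then show ?thesis unfolding \<rho>_def .
    qed
    finally show ?thesis using q by (simp add: field_simps)
  qed
  have "(\<lambda>q. mlcs (9 * q) (9 * q) / real (9 * q)) \<longlonglongrightarrow> gamma_star 2"
    using LIMSEQ_subseq_LIMSEQ[OF gamma_star_limit, of "\<lambda>q. 9 * q"]
    by (simp add: strict_mono_def o_def)
  moreover have "(\<lambda>q. 8 / 9 + \<rho> ^ q) \<longlonglongrightarrow> 8 / 9 + 0"
    using \<rho> by (intro tendsto_intros LIMSEQ_power_zero) auto
  ultimately have "gamma_star 2 \<le> 8 / 9 + 0"
    by (rule LIMSEQ_le) (use le in \<open>auto intro: exI[of _ 1]\<close>)
  then show ?thesis by simp
qed

subsection \<open>The slope of the mean LCS function\<close>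

text \<open>If the maximum is attained at some \<open>q \<noteq> 0\<close>, then
  \<open>p = \<bar>q\<bar>\<close> loses nothing. Otherwise \<open>p_M 2 = 0\<close>, so
  \<open>gamma 2\<close> is differentiable at its maximum point and flat there to first
  order.\<close>

lemma gamma_near_max:
  assumes "gamma 2 differentiable (at (p_M 2))" "e > 0"
  obtains p where "0 < p" "p < 1" "gamma 2 p > gamma_star 2 - e * p"
proof (cases "\<exists>q. q \<noteq> 0 \<and> \<bar>q\<bar> < 1 \<and> gamma 2 q = gamma_star 2")
  case True
  then obtain q where "q \<noteq> 0" "\<bar>q\<bar> < 1" "gamma 2 q = gamma_star 2" by auto
  moreover have "gamma 2 \<bar>q\<bar> = gamma 2 q" using gamma_minus[of q] by (auto simp: abs_if)
  ultimately show ?thesis using that[of "\<bar>q\<bar>"] assms(2) by auto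
next
  case False
  have "p_M 2 = 0"
    unfolding p_M_def
  proof (rule Greatest_equality)
    fix q assume "q \<in> {-1<..<1} \<and> gamma 2 q = gamma 2 0"
    then have "\<bar>q\<bar> < 1" "gamma 2 q = gamma_star 2" using gamma_zero by auto
    then show "q \<le> 0" using False by auto
  qed simp
  then obtain D where D: "(gamma 2 has_real_derivative D) (at 0)"
    using assms(1) by (auto simp: real_differentiable_def)
  have "D = 0"
    using DERIV_local_max[OF D, of 1] gamma_le gamma_zero by auto
  then have "((\<lambda>h. (gamma 2 (0 + h) - gamma 2 0) / h) \<longlongrightarrow> 0) (at 0)"
    using D by (simp add: DERIV_def)
  then obtain s where s: "s > 0" "\<And>h. h \<noteq> 0 \<Longrightarrow> \<bar>h\<bar> < s \<Longrightarrow> \<bar>(gamma 2 h - gamma_star 2) / h\<bar> < e"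
    using assms(2) by (force simp: LIM_eq gamma_zero)
  define h where "h = min s 1 / 2"
  have h: "0 < h" "h < 1" "h < s" using s by (auto simp: h_def)
  then have "\<bar>(gamma 2 h - gamma_star 2) / h\<bar> < e" by (intro s(2)) auto
  then have "- e < (gamma 2 h - gamma_star 2) / h" by linarith
  then have "- e * h < gamma 2 h - gamma_star 2" using h by (simp add: pos_less_divide_eq)
  then show ?thesis using that[of h] h by (simp add: algebra_simps)
qed

text \<open>By concavity in the second length, it suffices to bound one difference quotient over an interval
  of length proportional to \<open>m\<close> below the diagonal. There \<open>mlcs m a\<close> is close to
  \<open>gamma_star 2 * (m + a) / 2\<close>, so that the slope is about \<open>gamma_star 2 / 2 < 1 / 2\<close>.\<close>

lemma mlcs_slope:
  assumes diff: "gamma 2 differentiable (at (p_M 2))" and g1: "gamma_star 2 < 1" and g2: "1 / 2 < gamma_star 2"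
  obtains \<kappa> \<rho> m0 where "\<kappa> < 1 / 2" "\<rho> > 0" "\<rho> < 1"
    "\<And>m n k. m \<ge> m0 \<Longrightarrow> (1 - \<rho>) * real m \<le> real n \<Longrightarrow> mlcs m (n + k) - mlcs m n \<le> \<kappa> * real k"
proof -
  \<comment> \<open>Since \<open>\<gamma> = 1 - 8 * \<epsilon>\<close>, the difference quotient of
    about \<open>(\<gamma> + \<epsilon>) / (2 - \<epsilon>)\<close> found below is less than
    \<open>1 / 2 - \<epsilon>\<close>.\<close>
  define \<gamma> \<epsilon> where "\<gamma> = gamma_star 2" and "\<epsilon> = (1 - \<gamma>) / 8"
  have \<epsilon>: "0 < \<epsilon>" "\<epsilon> < 1 / 16" "\<gamma> = 1 - 8 * \<epsilon>" using g1 g2 by (auto simp: \<epsilon>_def \<gamma>_def field_simps)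
  obtain p where p: "0 < p" "p < 1" "gamma 2 p > \<gamma> - \<epsilon> * p"
    using gamma_near_max[OF diff \<epsilon>(1)] unfolding \<gamma>_def by blast
  \<comment> \<open>For \<open>N\<close> about \<open>(1 - c) * m\<close>, the longer length
    \<open>N * (1 + p)\<close> is about \<open>m\<close> and the shorter one
    \<open>N * (1 - p)\<close> about \<open>(1 - 2 * c) * m\<close>.\<close>
  define c where "c = p / (1 + p)"
  have c: "0 < c" "c < 1 / 2" using p by (auto simp: c_def field_simps)
  have cp: "(1 - c) * (1 + p) = 1" "(1 - c) * p = c" "(1 - c) * (1 - p) = 1 - 2 * c"
    using p by (auto simp: c_def field_simps)
  have "\<forall>\<^sub>F N in sequentially. gamma_n 2 N p > \<gamma> - \<epsilon> * p"
    using p by (intro order_tendstoD(1)[OF gamma_n_limit]) auto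
  then obtain N0 where N0: "\<And>N. N \<ge> N0 \<Longrightarrow> gamma_n 2 N p > \<gamma> - \<epsilon> * p"
    by (auto simp: eventually_sequentially)
  define m1 where "m1 = max ((real N0 + 3) / (1 - c)) (3 / (c * \<epsilon>))"
  \<comment> \<open>Small enough that the interval from \<open>a\<close> to \<open>b\<close>, with
    \<open>b\<close> about \<open>(1 - \<rho>) * m\<close>, still has length about
    \<open>(2 - \<epsilon>) * c * m\<close>.\<close>
  define \<rho> where "\<rho> = \<epsilon> * c"
  have \<rho>1: "0 < \<rho>" "\<rho> < 1"
    using \<epsilon> c mult_strict_mono[of \<epsilon> 1 c 1] by (auto simp: \<rho>_def)
  have main: "mlcs m (n + k) - mlcs m n \<le> (1 / 2 - \<epsilon>) * real k"
    if m: "real m \<ge> m1" and n: "(1 - \<rho>) * real m \<le> real n" for m n k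
  proof -
    have m0: "(1 - c) * real m \<ge> real N0 + 3" "c * \<epsilon> * real m \<ge> 3"
      using m c \<epsilon> by (auto simp: m1_def field_simps)
    \<comment> \<open>Subtracting 1 from \<open>m\<close> leaves room for rounding
      \<open>N * (1 + p)\<close> up.\<close>
    define N where "N = nat \<lfloor>(1 - c) * (real m - 1)\<rfloor>"
    have "(1 - c) * (real m - 1) \<ge> 0" using m0 c by (simp add: algebra_simps)
    then have N: "real N \<le> (1 - c) * (real m - 1)" "real N \<ge> (1 - c) * real m - 2"
      unfolding N_def using c by (auto simp: algebra_simps) linarith+
    then have NN: "N \<ge> N0" "N \<ge> 1" using m0 by linarith+
    note pos = scaled_lengths_pos[of p N]
    define a where "a = round_pos (real N - real N * p)"
    have "real N * (1 + p) \<le> (1 - c) * (real m - 1) * (1 + p)"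
      using N p by (intro mult_right_mono) auto
    also have "\<dots> = real m - 1" using cp(1) by (metis mult.commute mult.left_commute mult.right_neutral)
    finally have "round_pos (real N + real N * p) \<le> m"
      using round_pos_close[OF pos(2)] p NN by (auto simp: algebra_simps)
    then have "mlcs (round_pos (real N + real N * p)) a \<le> mlcs m a"
      by (rule mlcs_left_mono)
    moreover have "(\<gamma> - \<epsilon> * p) * real N \<le> mlcs a (round_pos (real N + real N * p))"
      using N0[OF NN(1)] NN(2) unfolding gamma_n_def a_def by (simp add: pos_less_divide_eq)
    moreover have "(\<gamma> - \<epsilon> * p) * ((1 - c) * real m - 2) \<le> (\<gamma> - \<epsilon> * p) * real N"
    proof -
      have "\<epsilon> * p \<le> \<epsilon> * 1" using \<epsilon> p by (intro mult_left_mono) auto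
      then have "0 \<le> \<gamma> - \<epsilon> * p" using \<epsilon> by linarith
      then show ?thesis using N by (intro mult_left_mono)
    qed
    moreover have "(\<gamma> - \<epsilon> * p) * ((1 - c) * real m - 2)
        = \<gamma> * real m - (\<gamma> + \<epsilon>) * c * real m - 2 * (\<gamma> - \<epsilon> * p)"
    proof -
      have "(\<gamma> - \<epsilon> * p) * ((1 - c) * real m - 2)
          = \<gamma> * ((1 - c) * real m) - \<epsilon> * ((1 - c) * p) * real m - 2 * (\<gamma> - \<epsilon> * p)"
        by (simp add: algebra_simps)
      then show ?thesis unfolding cp(2) by (simp add: algebra_simps)
    qed
    moreover have "\<gamma> - \<epsilon> * p \<le> 1" using \<epsilon> p mult_pos_pos[of \<epsilon> p] by linarith
    ultimately have low: "\<gamma> * real m - (\<gamma> + \<epsilon>) * c * real m - 2 \<le> mlcs m a"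
      by (simp add: mlcs_commute)
    have "real a \<le> (1 - p) * real N + 1"
      using round_pos_close[OF pos(1)] p NN unfolding a_def by (auto simp: algebra_simps)
    also have "(1 - p) * real N \<le> (1 - p) * ((1 - c) * real m)"
      using N p c by (intro mult_left_mono) (auto simp: algebra_simps)
    also have "\<dots> = (1 - 2 * c) * real m" using cp(3) by (metis mult.assoc mult.commute)
    finally have a: "real a \<le> (1 - 2 * c) * real m + 1" by simp
    define b where "b = nat \<lceil>(1 - \<rho>) * real m\<rceil>"
    have "(1 - \<rho>) * real m \<le> 1 * real m" using \<rho>1 by (intro mult_right_mono) auto
    then have b: "(1 - \<rho>) * real m \<le> real b" "b \<le> n" "b \<le> m"
      using n unfolding b_def by (auto simp: nat_le_iff ceiling_le_iff intro: real_nat_ceiling_ge)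
    have "mlcs m b \<le> \<gamma> * real m"
      using mlcs_right_mono[OF b(3), of m] mlcs_diag_le[of m] by (simp add: \<gamma>_def)
    then have num: "mlcs m b - mlcs m a \<le> (\<gamma> + \<epsilon>) * (c * real m) + 2" using low by (simp add: mult.assoc)
    have "(1 - \<rho>) * real m - ((1 - 2 * c) * real m + 1) = (2 - \<epsilon>) * (c * real m) - 1"
      by (simp add: \<rho>_def algebra_simps)
    then have den: "real b - real a \<ge> (2 - \<epsilon>) * (c * real m) - 1" using a b(1) by linarith
    have cm: "\<epsilon> * (c * real m) \<ge> 3" using m0(2) by (simp add: mult_ac)
    have cm': "c * real m \<ge> 48"
    proof -
      have "\<epsilon> * (c * real m) \<le> (1 / 16) * (c * real m)" using \<epsilon> c by (intro mult_right_mono) auto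
      then show ?thesis using cm by linarith
    qed
    have "(2 - \<epsilon>) * (c * real m) \<ge> 1 * (c * real m)" using \<epsilon> cm' by (intro mult_right_mono) auto
    then have ab: "real a < real b" using den cm' by linarith
    have "(1 / 2 - \<epsilon>) * ((2 - \<epsilon>) * (c * real m) - 1) \<le> (1 / 2 - \<epsilon>) * (real b - real a)"
      using den \<epsilon> by (intro mult_left_mono) auto
    \<comment> \<open>Both sides agree at order \<open>c * m\<close>; the surplus
      \<open>9 / 2 * (\<epsilon> * (c * m))\<close> absorbs the constants by
      \<open>cm\<close>.\<close>
    moreover have "(\<gamma> + \<epsilon>) * (c * real m) + 2 \<le> (1 / 2 - \<epsilon>) * ((2 - \<epsilon>) * (c * real m) - 1)"
    proof -
      have "(1 / 2 - \<epsilon>) * ((2 - \<epsilon>) * (c * real m) - 1) - ((\<gamma> + \<epsilon>) * (c * real m) + 2)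
          = 9 / 2 * (\<epsilon> * (c * real m)) + \<epsilon> * (\<epsilon> * (c * real m)) - 5 / 2 + \<epsilon>"
        by (simp add: \<epsilon>(3) algebra_simps)
      moreover have "0 \<le> \<epsilon> * (\<epsilon> * (c * real m))" using \<epsilon> c by simp
      ultimately show ?thesis using cm \<epsilon> by linarith
    qed
    ultimately have "mlcs m b - mlcs m a \<le> (1 / 2 - \<epsilon>) * (real b - real a)" using num by linarith
    then have "(mlcs m b - mlcs m a) / (real b - real a) \<le> 1 / 2 - \<epsilon>"
      using ab by (simp add: pos_divide_le_eq)
    then have "real k * ((mlcs m b - mlcs m a) / (real b - real a)) \<le> real k * (1 / 2 - \<epsilon>)"
      by (intro mult_left_mono) auto
    moreover have "mlcs m (n + k) - mlcs m n \<le> real k * ((mlcs m b - mlcs m a) / (real b - real a))"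
      using ab b by (intro concave_slope_le mlcs_concave) auto
    ultimately show ?thesis by (simp add: mult.commute)
  qed
  show ?thesis
  proof (rule that[of "1 / 2 - \<epsilon>" \<rho> "nat \<lceil>m1\<rceil>"])
    show "1 / 2 - \<epsilon> < 1 / 2" "\<rho> > 0" "\<rho> < 1" using \<epsilon> \<rho>1 by auto
  next
    fix m n k assume "nat \<lceil>m1\<rceil> \<le> m" "(1 - \<rho>) * real m \<le> real n"
    then show "mlcs m (n + k) - mlcs m n \<le> (1 / 2 - \<epsilon>) * real k"
      by (intro main) linarith+
  qed
qed

subsection \<open>Words with regular letter counts and common subsequences\<close>

text \<open>Splitting twice leaves the block aligned with the segment of \<open>y\<close> between
  the cuts \<open>i\<close> and \<open>j\<close>.\<close>

lemma lcs_length_block_le: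
  obtains i j where "i \<le> j" "j \<le> length y"
    "lcs_length (x @ replicate r b @ x') y
      = lcs_length x (take i y) + min r (count_list (drop i (take j y)) b) + lcs_length x' (drop j y)"
proof -
  obtain j where j: "j \<le> length y"
    "lcs_length ((x @ replicate r b) @ x') y = lcs_length (x @ replicate r b) (take j y) + lcs_length x' (drop j y)"
    by (rule lcs_length_append_split)
  obtain i where i: "i \<le> length (take j y)"
    "lcs_length (x @ replicate r b) (take j y)
      = lcs_length x (take i (take j y)) + lcs_length (replicate r b) (drop i (take j y))"
    by (rule lcs_length_append_split)
  have "i \<le> j" using i(1) j(1) by simp
  then show ?thesis
    using that[of i j] i(2) j by (simp add: lcs_length_replicate min_absorb1)
qed

lemma lcs_length_block_ge:
  assumes "i \<le> j"
  shows "lcs_length x (take i y) + min r (count_list (drop i (take j y)) b) + lcs_length x' (drop j y)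
    \<le> lcs_length (x @ replicate r b @ x') y"
proof -
  have y: "take i y @ drop i (take j y) @ drop j y = y"
    using assms by (metis append_assoc append_take_drop_id min.absorb1 take_take)
  have "lcs_length x (take i y) + lcs_length (replicate r b @ x') (drop i (take j y) @ drop j y)
      \<le> lcs_length (x @ replicate r b @ x') (take i y @ drop i (take j y) @ drop j y)"
    by (rule lcs_length_append_ge)
  moreover have "lcs_length (replicate r b) (drop i (take j y)) + lcs_length x' (drop j y)
      \<le> lcs_length (replicate r b @ x') (drop i (take j y) @ drop j y)"
    by (rule lcs_length_append_ge)
  ultimately show ?thesis unfolding y lcs_length_replicate by linarith
qed

lemma count_list_segment:
  assumes "i \<le> j"
  shows "count_list (take j y) b = count_list (take i y) b + count_list (drop i (take j y)) b"
  by (metis append_take_drop_id assms count_list_append min.absorb1 take_take)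

lemma count_list_binary:
  "set y \<subseteq> {..<2} \<Longrightarrow> count_list y 0 + count_list y (1::nat) = length y"
  by (induction y) (auto simp: less_2_cases_iff)

text \<open>The deterministic conditions that hold with high probability. They cover all cut points
  because the optimal cuts depend on the words; counts of the letter 1 follow since \<open>y\<close>
  is binary.\<close>

locale regular_words =
  fixes x x' y :: "nat list" and d m :: nat and t :: real
  assumes y: "y \<in> binary_words (2 * d)"
    and left: "\<And>i. i \<le> 2 * d \<Longrightarrow> \<bar>real (lcs_length x (take i y)) - mlcs m i\<bar> < t"
    and right: "\<And>j. j \<le> 2 * d \<Longrightarrow> \<bar>real (lcs_length x' (drop j y)) - mlcs m (2 * d - j)\<bar> < t"
    and zeros: "\<And>i. i \<le> 2 * d \<Longrightarrow> \<bar>real (count_list (take i y) 0) - real i / 2\<bar> < t"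
begin

lemma length_y: "length y = 2 * d"
  using y by (rule length_binary_words)

lemma count_prefix:
  assumes "b < 2" "i \<le> 2 * d"
  shows "\<bar>real (count_list (take i y) b) - real i / 2\<bar> < t"
proof (cases "b = 0")
  case False
  then have "b = 1" using assms by simp
  have "set (take i y) \<subseteq> {..<2}"
    using y set_take_subset[of i y] by (auto simp: binary_words_def)
  then have "count_list (take i y) 0 + count_list (take i y) 1 = i"
    using count_list_binary[of "take i y"] assms length_y by simp
  then show ?thesis using zeros[OF assms(2)] unfolding \<open>b = 1\<close> by linarith
qed (use zeros assms in simp)

lemma count_segment:
  assumes "b < 2" "i \<le> j" "j \<le> 2 * d"
  shows "\<bar>real (count_list (drop i (take j y)) b) - (real j - real i) / 2\<bar> < 2 * t"
  using count_list_segment[OF assms(2), of y b] count_prefix[OF assms(1,3)]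
    count_prefix[of b i] assms by (simp add: diff_divide_distrib)

text \<open>As the segment length \<open>s\<close> grows, the outer parts lose at rate
  \<open>gamma_star 2 / 2\<close> and the block gains at rate \<open>1 / 2\<close> until
  \<open>s = 2 * l\<close>, where the bound is largest. The error is \<open>t\<close> for each outer
  part and \<open>2 * t\<close> for the segment.\<close>

lemma lcs_block_le:
  assumes b: "b < 2" and l: "m + l div 2 = d" "even l" and g: "gamma_star 2 \<le> 1" "0 \<le> gamma_star 2"
  shows "real (lcs_length (x @ replicate l b @ x') y)
    \<le> gamma_star 2 * (2 * real d) - (3 * gamma_star 2 / 2 - 1) * real l + 4 * t"
proof -
  obtain i j where ij: "i \<le> j" "j \<le> 2 * d"
    "lcs_length (x @ replicate l b @ x') y
      = lcs_length x (take i y) + min l (count_list (drop i (take j y)) b) + lcs_length x' (drop j y)"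
    using lcs_length_block_le length_y by metis
  define s where "s = real j - real i"
  have "mlcs m i + mlcs m (2 * d - j) \<le> gamma_star 2 * real (m + i) / 2 + gamma_star 2 * real (m + (2 * d - j)) / 2"
    by (intro add_mono mlcs_le)
  also have "\<dots> = gamma_star 2 * (2 * real d) - gamma_star 2 * (real l / 2 + s / 2)"
  proof -
    have m: "real m = real d - real l / 2" using l by auto
    have j: "real (2 * d - j) = 2 * real d - real j" using ij by (simp add: of_nat_diff)
    show ?thesis unfolding of_nat_add m j s_def by (simp add: field_simps)
  qed
  finally have means: "mlcs m i + mlcs m (2 * d - j) \<le> gamma_star 2 * (2 * real d) - gamma_star 2 * (real l / 2 + s / 2)" .
  have "real (min l (count_list (drop i (take j y)) b)) \<le> gamma_star 2 * (s / 2) + (1 - gamma_star 2) * real l + 2 * t"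
  proof (cases "s / 2 \<le> real l")
    case True
    then have "(1 - gamma_star 2) * (s / 2) \<le> (1 - gamma_star 2) * real l"
      using g by (intro mult_left_mono) auto
    moreover have "(1 - gamma_star 2) * (s / 2) = s / 2 - gamma_star 2 * (s / 2)"
      by (simp add: algebra_simps)
    moreover have "real (count_list (drop i (take j y)) b) < s / 2 + 2 * t"
      using count_segment[OF b ij(1,2)] unfolding abs_diff_less_iff s_def by linarith
    moreover have "real (min l (count_list (drop i (take j y)) b)) \<le> real (count_list (drop i (take j y)) b)"
      by simp
    ultimately show ?thesis by linarith
  next
    case False
    then have "gamma_star 2 * real l \<le> gamma_star 2 * (s / 2)"
      using g by (intro mult_left_mono) auto
    moreover have "t \<ge> 0" using zeros[of 0] by simp
    ultimately show ?thesis by (simp add: algebra_simps)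
  qed
  then show ?thesis
    using means left[of i] right[of j] ij by (simp add: algebra_simps)
qed

text \<open>Suppose that in an optimal alignment of the shortened block all letters \<open>b\<close> of its segment of
  \<open>y\<close> are matched. The segment then has length at most \<open>2 * l\<close>, so that the part of \<open>y\<close> aligned with
  \<open>x\<close> or the part aligned with \<open>x'\<close> has length at least \<open>d - l\<close>. Giving \<open>a\<close> letters of that part to the
  segment gains about \<open>a / 2\<close> and loses only about \<open>\<kappa> * a\<close>.\<close>

lemma lcs_block_shortened_less:
  assumes b: "b < 2" and a: "1 \<le> a" "a \<le> l" and al: "l + a \<le> d"
    and slope: "\<And>n k. n \<ge> d - l - a \<Longrightarrow> mlcs m (n + k) - mlcs m n \<le> \<kappa> * real k"
    and t: "2 * t \<le> real a" "4 * t \<le> (1 / 2 - \<kappa>) * real a"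
  shows "lcs_length (x @ replicate (l - a) b @ x') y < lcs_length (x @ replicate l b @ x') y"
proof -
  obtain i j where ij: "i \<le> j" "j \<le> 2 * d"
    "lcs_length (x @ replicate (l - a) b @ x') y
      = lcs_length x (take i y) + min (l - a) (count_list (drop i (take j y)) b) + lcs_length x' (drop j y)"
    using lcs_length_block_le length_y by metis
  let ?c = "\<lambda>i j. count_list (drop i (take j y)) b"
  note ge = lcs_length_block_ge[where x = x and x' = x' and r = l and b = b and y = y]
  have c_add: "?c i k = ?c i j + ?c j k" if "i \<le> j" "j \<le> k" for i j k
    using count_list_segment[of i j y b] count_list_segment[of j k y b] count_list_segment[of i k y b] that
    by simp
  have c_le: "?c i j \<le> j - i" for i j
    using count_le_length[of "drop i (take j y)" b] by simp
  show ?thesis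
  proof (cases "?c i j > l - a")
    case True
    \<comment> \<open>The segment contains unmatched letters \<open>b\<close>, so the longer block
      gains without moving the cuts.\<close>
    then show ?thesis using ge[OF ij(1)] ij(3) a by simp
  next
    case False
    then have "real (?c i j) \<le> real l - real a" using a by linarith
    then have "real j - real i < 2 * real l"
      using count_segment[OF b ij(1,2)] t(1) unfolding abs_diff_less_iff by argo
    then have "j < i + 2 * l" by linarith
    then consider "i \<ge> d - l" | "2 * d - j \<ge> d - l" by linarith
    then show ?thesis
    proof cases
      case 1
      define n where "n = i - a"
      have n: "i = n + a" "n \<ge> d - l - a" using 1 al unfolding n_def by linarith+
      have "?c n i + ?c i j \<le> l" using c_le[of n i] n False a by simp
      then have "lcs_length x (take n y) + (?c n i + ?c i j) + lcs_length x' (drop j y)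
          \<le> lcs_length (x @ replicate l b @ x') y"
        using ge[of n j] c_add[of n i j] n ij by simp
      moreover have "real a / 2 - 2 * t < real (?c n i)"
        using count_segment[OF b, of n i] n ij by simp
      moreover have "mlcs m i - mlcs m n \<le> \<kappa> * real a" using slope[OF n(2), of a] n by simp
      \<comment> \<open>The gain exceeds \<open>a / 2 - 2 * t\<close> and the cost is below
        \<open>\<kappa> * a + 2 * t\<close>; the bound on \<open>4 * t\<close> makes the balance
        positive.\<close>
      ultimately show ?thesis
        using left[of i] left[of n] t n ij False by (simp add: algebra_simps)
    next
      case 2
      define n where "n = 2 * d - j - a"
      have n: "2 * d - j = n + a" "n \<ge> d - l - a" "2 * d - (j + a) = n" "j + a \<le> 2 * d"
        using 2 al ij unfolding n_def by linarith+
      have "?c i j + ?c j (j + a) \<le> l" using c_le[of j "j + a"] False a by simp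
      then have "lcs_length x (take i y) + (?c i j + ?c j (j + a)) + lcs_length x' (drop (j + a) y)
          \<le> lcs_length (x @ replicate l b @ x') y"
        using ge[of i "j + a"] c_add[of i j "j + a"] ij(1) by simp
      moreover have "real a / 2 - 2 * t < real (?c j (j + a))"
        using count_segment[OF b, of j "j + a"] n(4) by simp
      moreover have "mlcs m (2 * d - j) - mlcs m n \<le> \<kappa> * real a"
        using slope[OF n(2), of a] unfolding n(1) .
      moreover have "mlcs m n - t < real (lcs_length x' (drop (j + a) y))"
        using right[OF n(4)] unfolding n(3) abs_diff_less_iff by linarith
      moreover have "real (lcs_length x' (drop j y)) < mlcs m (2 * d - j) + t"
        using right[OF ij(2)] unfolding abs_diff_less_iff by linarith
      moreover have "lcs_length (x @ replicate (l - a) b @ x') y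
          = lcs_length x (take i y) + ?c i j + lcs_length x' (drop j y)"
        using ij(3) False by simp
      ultimately show ?thesis
        using t(2) by (simp add: algebra_simps)
    qed
  qed
qed

end

section \<open>Letter counts of uniform words\<close>

lemma avg_count_zeros: "avg n (\<lambda>w. real (count_list w 0)) = real n / 2"
proof (induction n)
  case (Suc n)
  then show ?case using avg_add[of n "\<lambda>_. 1" "\<lambda>w. real (count_list w 0)"] by (simp add: field_simps)
qed simp

lemma word_lipschitz_count: "word_lipschitz (\<lambda>w. real (count_list w b))"
  by (auto simp: word_lipschitz_def)

lemma avg_flip: "avg n (\<lambda>w. F (map (\<lambda>a. 1 - a) w)) = avg n F"
proof (induction n arbitrary: F)
  case (Suc n)
  show ?case using Suc[of "\<lambda>w. F (0 # w)"] Suc[of "\<lambda>w. F (1 # w)"] by simp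
qed simp

text \<open>By symmetry; the tie contributes the excess over \<open>1 / 2\<close>.\<close>

lemma avg_majority:
  assumes "b < 2"
  shows "avg (2 * h) (\<lambda>w. of_bool (h \<le> count_list w b)) \<ge> 1 / 2 + 1 / (2 * 4 ^ h)"
proof -
  let ?F = "\<lambda>b w. of_bool (h \<le> count_list w b) :: real"
  have "avg (2 * h) (?F 1) = avg (2 * h) (\<lambda>w. ?F 0 (map (\<lambda>a. 1 - a) w))"
  proof (rule avg_cong)
    fix w assume "w \<in> binary_words (2 * h)"
    then have "set w \<subseteq> {..<2}" by (simp add: binary_words_def)
    then have "count_list w 1 = count_list (map (\<lambda>a. 1 - a) w) 0"
      by (induction w) (auto simp: less_2_cases_iff)
    then show "?F 1 w = ?F 0 (map (\<lambda>a. 1 - a) w)" by simp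
  qed
  then have sym: "avg (2 * h) (?F 1) = avg (2 * h) (?F 0)" using avg_flip[of "2 * h" "?F 0"] by simp
  \<comment> \<open>One tied word is enough: it lies in both majority events and has weight
    \<open>1 / 4 ^ h\<close>.\<close>
  let ?w = "replicate h 0 @ replicate h (1::nat)"
  have w: "?w \<in> binary_words (2 * h)" by (auto simp: binary_words_def)
  have "avg (2 * h) (\<lambda>w. 1 + of_bool (w = ?w)) \<le> avg (2 * h) (\<lambda>w. ?F 0 w + ?F 1 w)"
  proof (rule avg_mono)
    fix w assume "w \<in> binary_words (2 * h)"
    then have "count_list w 0 + count_list w 1 = 2 * h"
      using count_list_binary[of w] by (simp add: binary_words_def)
    moreover have "count_list ?w 0 = h \<and> count_list ?w 1 = h" by (simp add: count_list_eq_length_filter)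
    ultimately show "1 + of_bool (w = ?w) \<le> ?F 0 w + ?F 1 w"
      by (cases "w = ?w") auto
  qed
  moreover have "avg (2 * h) (\<lambda>w. of_bool (w = ?w)) = 1 / 4 ^ h"
    unfolding avg_eq_sum using w by (simp add: sum.If_cases of_bool_def power_mult)
  ultimately have "1 + 1 / 4 ^ h \<le> 2 * avg (2 * h) (?F 0)"
    using sym by (simp add: avg_add)
  then have "1 / 2 + 1 / (2 * 4 ^ h) \<le> avg (2 * h) (?F 0)" by (simp add: field_simps)
  then show ?thesis using sym assms by (auto simp: less_2_cases_iff)
qed

subsection \<open>The block model\<close>

lemma length_word [simp]: "length (word Z i j \<omega>) = Suc j - i"
  by (simp add: word_def del: upt_Suc)

lemma word_append:
  assumes "i \<le> Suc j" "j \<le> k"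
  shows "word Z i k \<omega> = word Z i j \<omega> @ word Z (Suc j) k \<omega>"
  using assms upt_add_eq_append[of i "Suc j" "k - j"]
  unfolding word_def by (simp del: upt_Suc flip: map_append)

lemma word_eq_drop_take:
  assumes "1 \<le> i" "j \<le> n"
  shows "word Z i j \<omega> = drop (i - 1) (take j (word Z 1 n \<omega>))"
  using assms unfolding word_def by (simp add: drop_map take_map take_upt del: upt_Suc)

lemma word_constant:
  assumes "\<And>m. m \<in> {i..j} \<Longrightarrow> Z m \<omega> = b"
  shows "word Z i j \<omega> = replicate (Suc j - i) b"
  using assms unfolding word_def by (intro replicate_eqI) auto

text \<open>The second constant makes the required probability equal to \<open>\<delta>\<close> at
  \<open>d0\<close>, and smaller \<open>d\<close> require less. Below \<open>d0\<close> a fixed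
  positive probability therefore suffices.\<close>

lemma exp_rate_combine:
  assumes large: "d \<ge> d0 \<Longrightarrow> \<Delta> \<ge> 1 - exp (- c * real d powr e)"
    and small: "d < d0 \<Longrightarrow> \<Delta> \<ge> \<delta>"
    and "d \<ge> 1" "d0 \<ge> 1" "e \<ge> 0" "0 < \<delta>" "\<delta> < 1"
  shows "\<Delta> \<ge> 1 - exp (- min c (- ln (1 - \<delta>) / real d0 powr e) * real d powr e)"
proof (cases "d \<ge> d0")
  case True
  have "min c (- ln (1 - \<delta>) / real d0 powr e) * real d powr e \<le> c * real d powr e"
    by (intro mult_right_mono) auto
  then have "exp (- c * real d powr e) \<le> exp (- min c (- ln (1 - \<delta>) / real d0 powr e) * real d powr e)"
    by simp
  then show ?thesis using large[OF True] by linarith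
next
  case False
  let ?C = "- ln (1 - \<delta>) / real d0 powr e"
  have C: "?C \<ge> 0" using assms by (intro divide_nonneg_nonneg) auto
  have "min c ?C * real d powr e \<le> ?C * real d powr e"
    by (intro mult_right_mono) auto
  also have "\<dots> \<le> ?C * real d0 powr e"
    using False assms C by (intro mult_left_mono powr_mono2) auto
  also have "\<dots> = - ln (1 - \<delta>)" using assms by simp
  finally have "ln (1 - \<delta>) \<le> - min c ?C * real d powr e" by simp
  then have "exp (ln (1 - \<delta>)) \<le> exp (- min c ?C * real d powr e)" by simp
  then have "1 - \<delta> \<le> exp (- min c ?C * real d powr e)" using assms by simp
  then show ?thesis using small False by linarith
qed

section \<open>Pairs of independent uniform words\<close>

context prob_space
begin

text \<open>Words form a countable type, so every predicate on them gives an event.\<close>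

lemma measurable_word_pred:
  fixes Q :: "nat list \<Rightarrow> nat list \<Rightarrow> bool"
  assumes "random_variable (count_space UNIV) U" "random_variable (count_space UNIV) V"
  shows "{\<omega> \<in> space M. Q (U \<omega>) (V \<omega>)} \<in> events"
proof -
  have "Measurable.pred M (\<lambda>\<omega>. Q u (V \<omega>))" for u
    using assms(2) by (rule measurable_compose) simp
  then have "Measurable.pred M (\<lambda>\<omega>. Q (U \<omega>) (V \<omega>))"
    using assms(1) by (rule measurable_compose_countable)
  then show ?thesis by (simp add: pred_def)
qed

text \<open>Membership in \<open>binary_words\<close> holds at every point of
  \<open>space M\<close>, so that events decompose exactly into finitely many atoms of known
  probability.\<close>

definition uniform_pair :: "nat \<Rightarrow> nat \<Rightarrow> ('a \<Rightarrow> nat list) \<Rightarrow> ('a \<Rightarrow> nat list) \<Rightarrow> bool" where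
  "uniform_pair m n U V \<longleftrightarrow>
     random_variable (count_space UNIV) U \<and> random_variable (count_space UNIV) V \<and>
     (\<forall>\<omega>\<in>space M. U \<omega> \<in> binary_words m \<and> V \<omega> \<in> binary_words n) \<and>
     (\<forall>u\<in>binary_words m. \<forall>v\<in>binary_words n. prob {\<omega> \<in> space M. U \<omega> = u \<and> V \<omega> = v} = 1 / 2 ^ m * (1 / 2 ^ n))"

lemma uniform_pair_prob:
  assumes "uniform_pair m n U V"
  shows "prob {\<omega> \<in> space M. Q (U \<omega>) (V \<omega>)} = avg m (\<lambda>u. avg n (\<lambda>v. of_bool (Q u v)))"
proof -
  let ?S = "{(u, v) \<in> binary_words m \<times> binary_words n. Q u v}"
  let ?E = "\<lambda>(u, v). {\<omega> \<in> space M. U \<omega> = u \<and> V \<omega> = v}"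
  have "?S \<subseteq> binary_words m \<times> binary_words n" by auto
  then have fin: "finite ?S" by (rule finite_subset) simp
  have "{\<omega> \<in> space M. Q (U \<omega>) (V \<omega>)} = (\<Union>a\<in>?S. ?E a)"
    using assms by (auto simp: uniform_pair_def)
  then have "prob {\<omega> \<in> space M. Q (U \<omega>) (V \<omega>)} = prob (\<Union>a\<in>?S. ?E a)" by simp
  also have "\<dots> = (\<Sum>a\<in>?S. prob (?E a))"
    using assms fin
    by (intro finite_measure_finite_Union) (auto simp: uniform_pair_def disjoint_family_on_def
        intro!: measurable_word_pred[of U V "\<lambda>u v. u = _ \<and> v = _"])
  also have "\<dots> = (\<Sum>a\<in>?S. 1 / 2 ^ m * (1 / 2 ^ n))"
    using assms by (intro sum.cong) (auto simp: uniform_pair_def)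
  also have "\<dots> = (\<Sum>a\<in>binary_words m \<times> binary_words n. of_bool (case a of (u, v) \<Rightarrow> Q u v) * (1 / 2 ^ m * (1 / 2 ^ n)))"
    by (intro sum.mono_neutral_cong_left) auto
  also have "\<dots> = avg m (\<lambda>u. avg n (\<lambda>v. of_bool (Q u v)))"
    unfolding avg_eq_sum sum_divide_distrib sum.cartesian_product
    by (intro sum.cong) auto
  finally show ?thesis .
qed

text \<open>\<open>avg_avg_tail\<close> is applied to \<open>H\<close> and to its negative. The
  common bound \<open>N\<close> for the total length lets all deviation events share one
  estimate.\<close>

lemma uniform_pair_tail:
  assumes unif: "uniform_pair m n U V"
    and lip: "\<And>v. word_lipschitz (\<lambda>u. H u v)" "\<And>u. word_lipschitz (H u)"
    and mean: "avg m (\<lambda>u. avg n (H u)) = \<mu>" and t: "t \<ge> 0" and N: "m + n \<le> N" "0 < m + n"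
  shows "prob {\<omega> \<in> space M. \<not> \<bar>H (U \<omega>) (V \<omega>) - \<mu>\<bar> < t} \<le> 2 * exp (- 2 * t\<^sup>2 / real N)"
proof -
  have lip': "word_lipschitz (\<lambda>w. - F w)" if "word_lipschitz F" for F :: "nat list \<Rightarrow> real"
    using that unfolding word_lipschitz_def by (auto simp: abs_minus_commute)
  have neg: "avg m (\<lambda>u. avg n (\<lambda>v. - H u v)) = - \<mu>"
    using avg_cmult[of n "-1"] avg_cmult[of m "-1"] mean by simp
  have "prob {\<omega> \<in> space M. \<not> \<bar>H (U \<omega>) (V \<omega>) - \<mu>\<bar> < t}
      = avg m (\<lambda>u. avg n (\<lambda>v. of_bool (\<not> \<bar>H u v - \<mu>\<bar> < t)))"
    by (rule uniform_pair_prob[OF unif])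
  also have "\<dots> \<le> avg m (\<lambda>u. avg n (\<lambda>v. of_bool (H u v \<ge> \<mu> + t) + of_bool (- H u v \<ge> - \<mu> + t)))"
    by (intro avg_mono) auto
  also have "\<dots> \<le> exp (- 2 * t\<^sup>2 / real (m + n)) + exp (- 2 * t\<^sup>2 / real (m + n))"
    unfolding avg_add
    using avg_avg_tail[where H = H and m = m and n = n, OF lip t]
      avg_avg_tail[where H = "\<lambda>u v. - H u v" and m = m and n = n, OF lip'[OF lip(1)] lip'[OF lip(2)] t]
    unfolding mean neg by (intro add_mono)
  also have "\<dots> \<le> 2 * exp (- 2 * t\<^sup>2 / real N)"
  proof -
    have "2 * t\<^sup>2 / real N \<le> 2 * t\<^sup>2 / real (m + n)"
      using N by (intro divide_left_mono) auto
    then show ?thesis by simp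
  qed
  finally show ?thesis .
qed

lemma iid_uniform_word:
  assumes iid: "iid_uniform M 2 {i..j} Z" and w: "w \<in> binary_words (Suc j - i)"
  shows "prob {\<omega> \<in> space M. word Z i j \<omega> = w} = 1 / 2 ^ (Suc j - i)"
proof (cases "i \<le> j")
  case False
  \<comment> \<open>This covers the empty outer parts of \<open>X\<close> when the block fills the
    whole word.\<close>
  then have "{\<omega> \<in> space M. word Z i j \<omega> = w} = space M"
    using w by (auto simp: word_def)
  then show ?thesis using False by (simp add: prob_space)
next
  case True
  have indep: "indep_vars (\<lambda>_. count_space UNIV) Z {i..j}"
    and law: "\<And>m. m \<in> {i..j} \<Longrightarrow> distr M (count_space UNIV) (Z m) = measure_pmf (pmf_of_set {..<2})"
    using iid by (auto simp: iid_uniform_def)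
  have len: "length w = Suc j - i" "set w \<subseteq> {..<2}" using w by (auto simp: binary_words_def)
  have nth: "word Z i j \<omega> ! (m - i) = Z m \<omega>" if "m \<in> {i..j}" for m \<omega>
    using that unfolding word_def by (subst nth_map) (auto simp del: upt_Suc)
  have "word Z i j \<omega> = w \<longleftrightarrow> (\<forall>m\<in>{i..j}. Z m \<omega> = w ! (m - i))" for \<omega>
  proof
    assume *: "\<forall>m\<in>{i..j}. Z m \<omega> = w ! (m - i)"
    show "word Z i j \<omega> = w"
    proof (rule nth_equalityI)
      fix q assume "q < length (word Z i j \<omega>)"
      then have q: "i + q \<in> {i..j}" by auto
      show "word Z i j \<omega> ! q = w ! q"
        using nth[OF q, of \<omega>] bspec[OF * q] by simp
    qed (simp add: len)
  qed (use nth in auto)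
  then have "{\<omega> \<in> space M. word Z i j \<omega> = w} = (\<Inter>m\<in>{i..j}. Z m -` {w ! (m - i)} \<inter> space M)"
    using True by auto
  also have "prob \<dots> = (\<Prod>m\<in>{i..j}. prob (Z m -` {w ! (m - i)} \<inter> space M))"
    using True by (intro indep_varsD_finite[OF indep]) auto
  also have "\<dots> = (\<Prod>m\<in>{i..j}. 1 / 2)"
  proof (rule prod.cong)
    fix m assume m: "m \<in> {i..j}"
    have "Z m \<in> measurable M (count_space UNIV)" using indep m by (auto simp: indep_vars_def2)
    then have "prob (Z m -` {w ! (m - i)} \<inter> space M) = measure (distr M (count_space UNIV) (Z m)) {w ! (m - i)}"
      by (subst measure_distr) auto
    also have "\<dots> = pmf (pmf_of_set {..<2}) (w ! (m - i))"
      unfolding law[OF m] by (simp add: pmf.rep_eq)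
    also have "\<dots> = 1 / 2"
    proof -
      have "w ! (m - i) \<in> set w" using m len by (intro nth_mem) auto
      then show ?thesis using len by (auto simp: indicator_def lessThan_empty_iff)
    qed
    finally show "prob (Z m -` {w ! (m - i)} \<inter> space M) = 1 / 2" .
  qed simp
  also have "\<dots> = 1 / 2 ^ (Suc j - i)" by (simp add: power_divide)
  finally show ?thesis .
qed

end

text \<open>Taking half the block length as the parameter turns \<open>l div 2\<close> into
  \<open>h\<close>.\<close>

locale binary_block_model = block_model M 2 d "2 * h" X Y Xs
  for M :: "'w measure" and d h :: nat and X Y Xs :: "nat \<Rightarrow> 'w \<Rightarrow> nat" +
  assumes h: "1 \<le> h" "h \<le> d"
begin

abbreviation "xw \<equiv> word X 1 (2 * d)"
abbreviation "yw \<equiv> word Y 1 (2 * d)"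
abbreviation "xsw \<equiv> word Xs 1 (2 * d)"
abbreviation "lw \<equiv> word X 1 (d - h)"
abbreviation "rw \<equiv> word X (d + h + 1) (2 * d)"

lemma random_variable_words:
  "random_variable (count_space UNIV) xw" "random_variable (count_space UNIV) yw"
  "random_variable (count_space UNIV) xsw"
  using indep_X_Y indep_Xs_Y indep_var_rv1 indep_var_rv2 by blast+

lemma random_variable_subword:
  assumes "1 \<le> i" "j \<le> 2 * d"
  shows "random_variable (count_space UNIV) (word X i j)"
proof -
  have "random_variable (count_space UNIV) (\<lambda>\<omega>. drop (i - 1) (take j (xw \<omega>)))"
    by (rule measurable_compose[OF random_variable_words(1)]) simp
  moreover have "word X i j = (\<lambda>\<omega>. drop (i - 1) (take j (xw \<omega>)))"
    using word_eq_drop_take[OF assms] by (rule ext)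
  ultimately show ?thesis by simp
qed

lemma binary_word:
  assumes "\<And>m. m \<in> {1..2 * d} \<Longrightarrow> Z m \<in> measurable M (count_space {..<2})"
    and "1 \<le> i" "j \<le> 2 * d" "\<omega> \<in> space M"
  shows "word Z i j \<omega> \<in> binary_words (Suc j - i)"
proof -
  have "Z m \<omega> \<in> {..<2}" if "m \<in> {i..<Suc j}" for m
    using measurable_space[OF assms(1) assms(4), of m] that assms(2,3) by auto
  then show ?thesis by (auto simp: binary_words_def word_def simp del: upt_Suc)
qed

lemmas binary_subword = 
  binary_word[where Z = X, OF letters_X] binary_word[where Z = Y, OF letters_Y]
  binary_word[where Z = Xs, OF letters_Xs]

lemma uniform_pair_left: "uniform_pair (d - h) (2 * d) lw yw"
proof -
  let ?W = "\<lambda>j. [yw, lw, rw] ! j"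
  have "prob {\<omega> \<in> space M. lw \<omega> = u \<and> yw \<omega> = v} = 1 / 2 ^ (d - h) * (1 / 2 ^ (2 * d))"
    if "u \<in> binary_words (d - h)" "v \<in> binary_words (2 * d)" for u v
  proof -
    have "prob (\<Inter>j\<in>{0, 1}. ?W j -` {[v, u] ! j} \<inter> space M) = (\<Prod>j\<in>{0, 1}. prob (?W j -` {[v, u] ! j} \<inter> space M))"
      using indep_three by (intro indep_varsD[where I = "{..<3}"]) auto
    moreover have "(\<Inter>j\<in>{0, 1}. ?W j -` {[v, u] ! j} \<inter> space M) = {\<omega> \<in> space M. lw \<omega> = u \<and> yw \<omega> = v}"
      by auto
    moreover have "lw -` {u} \<inter> space M = {\<omega> \<in> space M. lw \<omega> = u}" "yw -` {v} \<inter> space M = {\<omega> \<in> space M. yw \<omega> = v}"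
      by auto
    ultimately show ?thesis
      using iid_uniform_word[of 1 "d - h" X u] iid_uniform_word[of 1 "2 * d" Y v] iid_left iid_Y that
      by simp
  qed
  then show ?thesis
    using random_variable_words(2) random_variable_subword[of 1 "d - h"]
      binary_subword(1)[of 1 "d - h"] binary_subword(2)[of 1 "2 * d"] h
    unfolding uniform_pair_def by auto
qed

lemma uniform_pair_right: "uniform_pair (d - h) (2 * d) rw yw"
proof -
  let ?W = "\<lambda>j. [yw, lw, rw] ! j"
  have "prob {\<omega> \<in> space M. rw \<omega> = u \<and> yw \<omega> = v} = 1 / 2 ^ (d - h) * (1 / 2 ^ (2 * d))"
    if "u \<in> binary_words (d - h)" "v \<in> binary_words (2 * d)" for u v
  proof -
    \<comment> \<open>The entry \<open>[]\<close> is a placeholder; only the indices 0 and 2 are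
      read.\<close>
    have "prob (\<Inter>j\<in>{0, 2}. ?W j -` {[v, [], u] ! j} \<inter> space M) = (\<Prod>j\<in>{0, 2}. prob (?W j -` {[v, [], u] ! j} \<inter> space M))"
      using indep_three by (intro indep_varsD[where I = "{..<3}"]) auto
    moreover have "(\<Inter>j\<in>{0, 2}. ?W j -` {[v, [], u] ! j} \<inter> space M) = {\<omega> \<in> space M. rw \<omega> = u \<and> yw \<omega> = v}"
      by auto
    moreover have "rw -` {u} \<inter> space M = {\<omega> \<in> space M. rw \<omega> = u}" "yw -` {v} \<inter> space M = {\<omega> \<in> space M. yw \<omega> = v}"
      by auto
    ultimately show ?thesis
      using iid_uniform_word[of "d + h + 1" "2 * d" X u] iid_uniform_word[of 1 "2 * d" Y v] iid_right iid_Y that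
      by simp
  qed
  then show ?thesis
    using random_variable_words(2) random_variable_subword[of "d + h + 1" "2 * d"]
      binary_subword(1)[of "d + h + 1" "2 * d"] binary_subword(2)[of 1 "2 * d"] h
    unfolding uniform_pair_def by auto
qed

lemma uniform_pair_Xs: "uniform_pair (2 * d) (2 * d) xsw yw"
proof -
  have "prob {\<omega> \<in> space M. xsw \<omega> = u \<and> yw \<omega> = v} = 1 / 2 ^ (2 * d) * (1 / 2 ^ (2 * d))"
    if "u \<in> binary_words (2 * d)" "v \<in> binary_words (2 * d)" for u v
  proof -
    have "prob ((\<lambda>\<omega>. (xsw \<omega>, yw \<omega>)) -` ({u} \<times> {v}) \<inter> space M) = prob (xsw -` {u} \<inter> space M) * prob (yw -` {v} \<inter> space M)"
      by (intro indep_varD[OF indep_Xs_Y]) auto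
    moreover have "(\<lambda>\<omega>. (xsw \<omega>, yw \<omega>)) -` ({u} \<times> {v}) \<inter> space M = {\<omega> \<in> space M. xsw \<omega> = u \<and> yw \<omega> = v}"
      by auto
    moreover have "xsw -` {u} \<inter> space M = {\<omega> \<in> space M. xsw \<omega> = u}" "yw -` {v} \<inter> space M = {\<omega> \<in> space M. yw \<omega> = v}"
      by auto
    ultimately show ?thesis
      using iid_uniform_word[of 1 "2 * d" Xs u] iid_uniform_word[of 1 "2 * d" Y v] iid_Xs iid_Y that
      by simp
  qed
  then show ?thesis
    using random_variable_words binary_subword(3)[of 1 "2 * d"] binary_subword(2)[of 1 "2 * d"]
    unfolding uniform_pair_def by auto
qed

definition good :: "real \<Rightarrow> 'w set" where
  "good t = {\<omega> \<in> space M. regular_words (lw \<omega>) (rw \<omega>) (yw \<omega>) d (d - h) t \<and>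
     \<bar>real (lcs_length (xsw \<omega>) (yw \<omega>)) - mlcs (2 * d) (2 * d)\<bar> < t}"

text \<open>A union bound over \<open>3 * (2 * d + 1) + 1 \<le> 10 * d\<close> deviations, each a
  function of at most \<open>4 * d\<close> letters. The event \<open>A\<close> is the complement of
  their union.\<close>

lemma prob_good:
  assumes t: "t \<ge> 0"
  obtains A where "A \<in> events" "A \<subseteq> good t" "prob A \<ge> 1 - 20 * real d * exp (- t\<^sup>2 / (2 * real d))"
proof -
  define \<epsilon> where "\<epsilon> = 2 * exp (- 2 * t\<^sup>2 / real (4 * d))"
  define A1 where "A1 i = {\<omega> \<in> space M. \<not> \<bar>real (lcs_length (lw \<omega>) (take i (yw \<omega>))) - mlcs (d - h) i\<bar> < t}" for i
  define A2 where "A2 i = {\<omega> \<in> space M. \<not> \<bar>real (lcs_length (rw \<omega>) (drop i (yw \<omega>))) - mlcs (d - h) (2 * d - i)\<bar> < t}" for i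
  define A3 where "A3 i = {\<omega> \<in> space M. \<not> \<bar>real (count_list (take i (yw \<omega>)) 0) - real i / 2\<bar> < t}" for i
  define A4 where "A4 = {\<omega> \<in> space M. \<not> \<bar>real (lcs_length (xsw \<omega>) (yw \<omega>)) - mlcs (2 * d) (2 * d)\<bar> < t}"
  have d: "d \<ge> 1" using h by linarith
  have rv: "random_variable (count_space UNIV) lw" "random_variable (count_space UNIV) rw"
    using uniform_pair_left uniform_pair_right by (auto simp: uniform_pair_def)
  have ev1: "A1 i \<in> events" for i
    unfolding A1_def by (rule measurable_word_pred[OF rv(1) random_variable_words(2)])
  have ev2: "A2 i \<in> events" for i
    unfolding A2_def by (rule measurable_word_pred[OF rv(2) random_variable_words(2)])
  have ev3: "A3 i \<in> events" for i
    unfolding A3_def by (rule measurable_word_pred[OF rv(1) random_variable_words(2)])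
  have ev4: "A4 \<in> events"
    unfolding A4_def by (rule measurable_word_pred[OF random_variable_words(3,2)])
  note ev = ev1 ev2 ev3 ev4
  note len = \<open>d \<ge> 1\<close> h
  have take: "word_lipschitz (\<lambda>v. F (take i v))" if "word_lipschitz F" for F i
    using word_lipschitz_take_drop[OF that word_lipschitz_const[of 0], of i] by simp
  have drop: "word_lipschitz (\<lambda>v. F (drop i v))" if "word_lipschitz F" for F i
    using word_lipschitz_take_drop[OF word_lipschitz_const[of 0] that, of i] by simp
  have p1: "prob (A1 i) \<le> \<epsilon>" if "i \<le> 2 * d" for i
    unfolding A1_def \<epsilon>_def
  proof (rule uniform_pair_tail[OF uniform_pair_left])
    show "avg (d - h) (\<lambda>u. avg (2 * d) (\<lambda>v. real (lcs_length u (take i v)))) = mlcs (d - h) i"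
      unfolding mean_lcs_eq_avg by (intro avg_cong avg_take[OF that])
  qed (use t len word_lipschitz_lcs take in auto)
  have p2: "prob (A2 i) \<le> \<epsilon>" if "i \<le> 2 * d" for i
    unfolding A2_def \<epsilon>_def
  proof (rule uniform_pair_tail[OF uniform_pair_right])
    show "avg (d - h) (\<lambda>u. avg (2 * d) (\<lambda>v. real (lcs_length u (drop i v)))) = mlcs (d - h) (2 * d - i)"
      unfolding mean_lcs_eq_avg by (intro avg_cong avg_drop[OF that])
  qed (use t len word_lipschitz_lcs drop in auto)
  have p3: "prob (A3 i) \<le> \<epsilon>" if "i \<le> 2 * d" for i
    unfolding A3_def \<epsilon>_def
  proof (rule uniform_pair_tail[OF uniform_pair_left, where H = "\<lambda>u v. real (count_list (take i v) 0)"])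
    show "avg (d - h) (\<lambda>u. avg (2 * d) (\<lambda>v. real (count_list (take i v) 0))) = real i / 2"
      using avg_take[OF that, of "\<lambda>v. real (count_list v 0)"] by (simp add: avg_count_zeros)
  qed (use t len word_lipschitz_const take[OF word_lipschitz_count] in auto)
  have p4: "prob A4 \<le> \<epsilon>"
    unfolding A4_def \<epsilon>_def
    by (rule uniform_pair_tail[OF uniform_pair_Xs]) (use t len word_lipschitz_lcs mean_lcs_eq_avg in auto)
  have union: "prob (\<Union>i\<le>2 * d. A i) \<le> (2 * real d + 1) * \<epsilon>"
    if "\<And>i. A i \<in> events" "\<And>i. i \<le> 2 * d \<Longrightarrow> prob (A i) \<le> \<epsilon>" for A :: "nat \<Rightarrow> 'w set"
  proof -
    have "prob (\<Union>i\<le>2 * d. A i) \<le> (\<Sum>i\<le>2 * d. prob (A i))"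
      using that by (intro finite_measure_subadditive_finite) auto
    also have "\<dots> \<le> (\<Sum>i\<le>2 * d. \<epsilon>)" using that by (intro sum_mono) auto
    finally show ?thesis by (simp add: add.commute)
  qed
  define B where "B = ((\<Union>i\<le>2 * d. A1 i) \<union> (\<Union>i\<le>2 * d. A2 i)) \<union> ((\<Union>i\<le>2 * d. A3 i) \<union> A4)"
  have Bev: "B \<in> events" unfolding B_def using ev by auto
  have "prob B \<le> (prob (\<Union>i\<le>2 * d. A1 i) + prob (\<Union>i\<le>2 * d. A2 i)) + (prob (\<Union>i\<le>2 * d. A3 i) + prob A4)"
    unfolding B_def using ev
    by (intro order_trans[OF measure_Un_le] add_mono measure_Un_le order_refl) auto
  also have "\<dots> \<le> ((2 * real d + 1) * \<epsilon> + (2 * real d + 1) * \<epsilon>) + ((2 * real d + 1) * \<epsilon> + \<epsilon>)"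
    using ev p1 p2 p3 p4 by (intro add_mono union) auto
  also have "\<dots> = (6 * real d + 4) * \<epsilon>" by (simp add: algebra_simps)
  also have "\<dots> \<le> 10 * real d * \<epsilon>" using d by (intro mult_right_mono) (auto simp: \<epsilon>_def)
  also have "\<dots> = 20 * real d * exp (- t\<^sup>2 / (2 * real d))" by (simp add: \<epsilon>_def)
  finally have pB: "prob B \<le> 20 * real d * exp (- t\<^sup>2 / (2 * real d))" .
  have "space M - B \<subseteq> good t"
  proof
    fix \<omega> assume \<omega>: "\<omega> \<in> space M - B"
    have "regular_words (lw \<omega>) (rw \<omega>) (yw \<omega>) d (d - h) t"
    proof
      show "yw \<omega> \<in> binary_words (2 * d)"
        using binary_subword(2)[of 1 "2 * d" \<omega>] \<omega> by simp
    qed (use \<omega> in \<open>auto simp: B_def A1_def A2_def A3_def\<close>)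
    then show "\<omega> \<in> good t" using \<omega> by (auto simp: good_def B_def A4_def)
  qed
  moreover have "prob (space M - B) \<ge> 1 - 20 * real d * exp (- t\<^sup>2 / (2 * real d))"
    using prob_compl[OF Bev] pB by simp
  ultimately show ?thesis using that[of "space M - B"] Bev by auto
qed

lemma block_words:
  assumes const: "\<forall>i\<in>{d - h + 1..d + h}. X i \<omega> = b" and a: "a \<le> 2 * h"
  shows "word X 1 (d - h) \<omega> @ word X (d - h + a + 1) (2 * d) \<omega> = lw \<omega> @ replicate (2 * h - a) b @ rw \<omega>"
proof -
  have "word X (d - h + a + 1) (2 * d) \<omega> = word X (d - h + a + 1) (d + h) \<omega> @ rw \<omega>"
    using word_append[of "d - h + a + 1" "d + h" "2 * d" X \<omega>] a h by simp
  moreover have "word X (d - h + a + 1) (d + h) \<omega> = replicate (Suc (d + h) - (d - h + a + 1)) b"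
    using const by (intro word_constant) auto
  moreover have "Suc (d + h) - (d - h + a + 1) = 2 * h - a" using h by simp
  ultimately show ?thesis by simp
qed

lemma xw_block:
  assumes const: "\<forall>i\<in>{d - h + 1..d + h}. X i \<omega> = b"
  shows "xw \<omega> = lw \<omega> @ replicate (2 * h) b @ rw \<omega>"
  using block_words[OF const, of 0] word_append[of 1 "d - h" "2 * d" X \<omega>] h by simp

lemma block_letter:
  "AE \<omega> in M. \<exists>b<2. X (d - h + 1) \<omega> = b \<and> (\<forall>i\<in>{d - h + 1..d + h}. X i \<omega> = b)"
proof -
  have "X (d - h + 1) \<omega> < 2" if "\<omega> \<in> space M" for \<omega>
    using measurable_space[OF letters_X that, of "d - h + 1"] h by auto
  then show ?thesis using block_constant AE_space by (auto elim: AE_mp intro!: AE_I2)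
qed

lemma G_event_sets: "G_event M d (2 * h) a X Y \<in> events"
proof -
  have eq: "word X i j = (\<lambda>\<omega>. drop (i - 1) (take j (xw \<omega>)))" if "1 \<le> i" "j \<le> 2 * d" for i j
    using word_eq_drop_take[OF that] by (rule ext)
  have "d - 2 * h div 2 \<le> 2 * d" by simp
  then show ?thesis
    unfolding G_event_def
    using measurable_word_pred[OF random_variable_words(1,2), of
        "\<lambda>u v. lcs_length u v > lcs_length (drop 0 (take (d - h) u) @ drop (d - h + a) (take (2 * d) u)) v"]
      eq[of 1 "d - h"] eq[of "d - h + a + 1" "2 * d"] by simp
qed

lemma H_event_sets: "H_event M d \<tau> X Y Xs \<in> events"
proof -
  \<comment> \<open>Three random words enter; the value \<open>v\<close> of \<open>xsw\<close> is
    fixed first and ranges over a countable type.\<close>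
  have "Measurable.pred M (\<lambda>\<omega>. real (lcs_length v (yw \<omega>)) - real (lcs_length (xw \<omega>) (yw \<omega>)) \<ge> \<tau>)" for v
    using measurable_word_pred[OF random_variable_words(1,2), of "\<lambda>u y. real (lcs_length v y) - real (lcs_length u y) \<ge> \<tau>"]
    by (simp add: pred_def)
  then have "Measurable.pred M (\<lambda>\<omega>. real (lcs_length (xsw \<omega>) (yw \<omega>)) - real (lcs_length (xw \<omega>) (yw \<omega>)) \<ge> \<tau>)"
    using random_variable_words(3) by (rule measurable_compose_countable)
  then show ?thesis by (simp add: pred_def H_event_def)
qed

lemma prob_G_large:
  assumes "1 \<le> a" "a \<le> 2 * h" "2 * h + a \<le> d" and t: "0 \<le> t" "2 * t \<le> real a" "4 * t \<le> (1 / 2 - \<kappa>) * real a"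
    and slope: "\<And>n k. n \<ge> d - 2 * h - a \<Longrightarrow> mlcs (d - h) (n + k) - mlcs (d - h) n \<le> \<kappa> * real k"
  shows "measure M (G_event M d (2 * h) a X Y) \<ge> 1 - 20 * real d * exp (- t\<^sup>2 / (2 * real d))"
proof -
  obtain A where A: "A \<in> events" "A \<subseteq> good t" "prob A \<ge> 1 - 20 * real d * exp (- t\<^sup>2 / (2 * real d))"
    using prob_good[OF t(1)] .
  have "prob A \<le> measure M (G_event M d (2 * h) a X Y)"
  proof (rule finite_measure_mono_AE)
    \<comment> \<open>The inclusion is only almost sure, like the constancy of the block.\<close>
    show "AE \<omega>\<in>A in M. \<omega> \<in> G_event M d (2 * h) a X Y"
      using block_letter
    proof (eventually_elim, intro impI)
      fix \<omega> assume b: "\<exists>b<2. X (d - h + 1) \<omega> = b \<and> (\<forall>i\<in>{d - h + 1..d + h}. X i \<omega> = b)" and "\<omega> \<in> A"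
      then obtain b where b: "b < 2" "\<forall>i\<in>{d - h + 1..d + h}. X i \<omega> = b" by blast
      have \<omega>: "\<omega> \<in> good t" using A \<open>\<omega> \<in> A\<close> by auto
      then interpret regular_words "lw \<omega>" "rw \<omega>" "yw \<omega>" d "d - h" t by (simp add: good_def)
      have "lcs_length (lw \<omega> @ replicate (2 * h - a) b @ rw \<omega>) (yw \<omega>) < lcs_length (lw \<omega> @ replicate (2 * h) b @ rw \<omega>) (yw \<omega>)"
        by (rule lcs_block_shortened_less[OF b(1)]) (use assms in auto)
      then show "\<omega> \<in> G_event M d (2 * h) a X Y"
        using \<omega> xw_block[OF b(2)] block_words[OF b(2) assms(2)] by (simp add: G_event_def good_def)
    qed
  qed (rule G_event_sets)
  then show ?thesis using A(3) by linarith
qed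

text \<open>Of the error \<open>5 * t\<close>, four parts come from the upper bound for
  \<open>xw\<close> and one from the deviation for \<open>xsw\<close>.\<close>

lemma prob_H_large:
  assumes t: "0 \<le> t"
    and \<tau>: "\<tau> \<le> mlcs (2 * d) (2 * d) - gamma_star 2 * (2 * real d) + (3 * gamma_star 2 / 2 - 1) * (2 * real h) - 5 * t"
  shows "measure M (H_event M d \<tau> X Y Xs) \<ge> 1 - 20 * real d * exp (- t\<^sup>2 / (2 * real d))"
proof -
  obtain A where A: "A \<in> events" "A \<subseteq> good t" "prob A \<ge> 1 - 20 * real d * exp (- t\<^sup>2 / (2 * real d))"
    using prob_good[OF t(1)] .
  have g: "gamma_star 2 \<le> 1" "0 \<le> gamma_star 2"
    using gamma_star_le mlcs_diag_le[of 1] mlcs_nonneg[of 1 1] by auto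
  have "prob A \<le> measure M (H_event M d \<tau> X Y Xs)"
  proof (rule finite_measure_mono_AE)
    show "AE \<omega>\<in>A in M. \<omega> \<in> H_event M d \<tau> X Y Xs"
      using block_letter
    proof (eventually_elim, intro impI)
      fix \<omega> assume b: "\<exists>b<2. X (d - h + 1) \<omega> = b \<and> (\<forall>i\<in>{d - h + 1..d + h}. X i \<omega> = b)" and "\<omega> \<in> A"
      then obtain b where b: "b < 2" "\<forall>i\<in>{d - h + 1..d + h}. X i \<omega> = b" by blast
      have \<omega>: "\<omega> \<in> good t" using A \<open>\<omega> \<in> A\<close> by auto
      then interpret regular_words "lw \<omega>" "rw \<omega>" "yw \<omega>" d "d - h" t by (simp add: good_def)
      have "real (lcs_length (xw \<omega>) (yw \<omega>)) \<le> gamma_star 2 * (2 * real d) - (3 * gamma_star 2 / 2 - 1) * real (2 * h) + 4 * t"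
        unfolding xw_block[OF b(2)] by (rule lcs_block_le[OF b(1)]) (use h g in auto)
      moreover have "real (lcs_length (xsw \<omega>) (yw \<omega>)) > mlcs (2 * d) (2 * d) - t"
        using \<omega> by (auto simp: good_def abs_less_iff)
      ultimately have "real (lcs_length (xsw \<omega>) (yw \<omega>)) - real (lcs_length (xw \<omega>) (yw \<omega>)) \<ge> \<tau>"
        using \<tau> by simp
      then show "\<omega> \<in> H_event M d \<tau> X Y Xs" using \<omega> by (simp add: H_event_def good_def)
    qed
  qed (rule H_event_sets)
  then show ?thesis using A(3) by linarith
qed

lemma prob_yw:
  assumes "v \<in> binary_words (2 * d)" shows "prob {\<omega> \<in> space M. yw \<omega> = v} = 1 / 4 ^ d"
  using iid_uniform_word[of 1 "2 * d" Y v] iid_Y assms by (simp add: power_mult)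

text \<open>Whatever the law of \<open>X\<close>, the independent uniform word \<open>yw\<close>
  equals \<open>xw\<close> with probability \<open>1 / 4 ^ d\<close>. Then the LCS length is
  \<open>2 * d\<close>, while the shortened word has fewer letters.\<close>

lemma prob_G_ge:
  assumes "1 \<le> a" shows "measure M (G_event M d (2 * h) a X Y) \<ge> 1 / 4 ^ d"
proof -
  let ?E = "\<lambda>v. {\<omega> \<in> space M. xw \<omega> = v \<and> yw \<omega> = v}"
  have ev: "{\<omega> \<in> space M. xw \<omega> = v} \<in> events" "?E v \<in> events" for v
    using measurable_word_pred[OF random_variable_words(1,2), of "\<lambda>x y. x = v"]
      measurable_word_pred[OF random_variable_words(1,2), of "\<lambda>x y. x = v \<and> y = v"] by auto
  have E: "prob (?E v) = prob {\<omega> \<in> space M. xw \<omega> = v} * (1 / 4 ^ d)" if "v \<in> binary_words (2 * d)" for v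
  proof -
    have "prob ((\<lambda>\<omega>. (xw \<omega>, yw \<omega>)) -` ({v} \<times> {v}) \<inter> space M) = prob (xw -` {v} \<inter> space M) * prob (yw -` {v} \<inter> space M)"
      by (intro indep_varD[OF indep_X_Y]) auto
    moreover have "(\<lambda>\<omega>. (xw \<omega>, yw \<omega>)) -` ({v} \<times> {v}) \<inter> space M = ?E v"
      "xw -` {v} \<inter> space M = {\<omega> \<in> space M. xw \<omega> = v}" "yw -` {v} \<inter> space M = {\<omega> \<in> space M. yw \<omega> = v}"
      by auto
    ultimately show ?thesis using prob_yw[OF that] by simp
  qed
  have "space M = (\<Union>v\<in>binary_words (2 * d). {\<omega> \<in> space M. xw \<omega> = v})"
    using binary_subword(1)[of 1 "2 * d"] by auto
  then have "1 = prob (\<Union>v\<in>binary_words (2 * d). {\<omega> \<in> space M. xw \<omega> = v})"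
    using prob_space by simp
  also have "\<dots> = (\<Sum>v\<in>binary_words (2 * d). prob {\<omega> \<in> space M. xw \<omega> = v})"
    using ev by (intro finite_measure_finite_Union) (auto simp: disjoint_family_on_def)
  finally have "1 / 4 ^ d = (\<Sum>v\<in>binary_words (2 * d). prob {\<omega> \<in> space M. xw \<omega> = v}) * (1 / 4 ^ d)"
    by simp
  also have "\<dots> = (\<Sum>v\<in>binary_words (2 * d). prob (?E v))"
    using E by (simp only: sum_distrib_right cong: sum.cong)
  also have "\<dots> = prob (\<Union>v\<in>binary_words (2 * d). ?E v)"
    using ev by (intro finite_measure_finite_Union[symmetric]) (auto simp: disjoint_family_on_def)
  also have "\<dots> \<le> measure M (G_event M d (2 * h) a X Y)"
  proof (rule finite_measure_mono[OF _ G_event_sets], safe)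
    fix \<omega> assume \<omega>: "\<omega> \<in> space M" "yw \<omega> = xw \<omega>"
    have "lcs_length (lw \<omega> @ word X (d - h + a + 1) (2 * d) \<omega>) (yw \<omega>) < 2 * d"
      using lcs_length_le_left[of "lw \<omega> @ word X (d - h + a + 1) (2 * d) \<omega>" "yw \<omega>"] assms h by simp
    then show "\<omega> \<in> G_event M d (2 * h) a X Y"
      using \<omega> by (simp add: G_event_def)
  qed
  finally show ?thesis .
qed

text \<open>One of the two letters, say \<open>c\<close>, has probability at least \<open>1 / 2\<close> to differ from the block letter.
  Nothing is known about the joint law of \<open>X\<close> and \<open>Xs\<close>, but with positive probability \<open>Y\<close> consists of \<open>c\<close>
  only, the block letter is not \<open>c\<close>, and at least half of the block of \<open>Xs\<close> is \<open>c\<close>.\<close>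

lemma prob_H_ge:
  assumes \<tau>: "\<tau> \<le> real h"
  shows "measure M (H_event M d \<tau> X Y Xs) \<ge> 1 / 4 ^ d * (1 / (2 * 4 ^ h))"
proof -
  \<comment> \<open>Lists are indexed from 0, so \<open>xw \<omega> ! (d - h)\<close> is
    \<open>X (d - h + 1) \<omega>\<close>, the first letter of the block.\<close>
  let ?E = "\<lambda>c. {\<omega> \<in> space M. xw \<omega> ! (d - h) \<noteq> c}"
  have Eev: "{\<omega> \<in> space M. xw \<omega> ! (d - h) \<noteq> c \<and> yw \<omega> = v} \<in> events" "?E c \<in> events" for c v
    using measurable_word_pred[OF random_variable_words(1,2), of "\<lambda>x y. x ! (d - h) \<noteq> c \<and> y = v"]
      measurable_word_pred[OF random_variable_words(1,2), of "\<lambda>x y. x ! (d - h) \<noteq> c"] by auto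
  have "space M = ?E 0 \<union> ?E 1" by auto
  then have "1 \<le> prob (?E 0) + prob (?E 1)"
    using measure_Un_le[OF Eev(2)[of 0] Eev(2)[of 1]] prob_space by simp
  then have "prob (?E 0) \<ge> 1 / 2 \<or> prob (?E 1) \<ge> 1 / 2" by linarith
  then obtain c where c: "c < 2" "prob (?E c) \<ge> 1 / 2"
    using one_less_numeral_iff semiring_norm(76) zero_less_numeral by blast
  define v where "v = replicate (2 * d) c"
  have v: "v \<in> binary_words (2 * d)" using c by (auto simp: v_def binary_words_def)
  define F where "F w \<longleftrightarrow> h \<le> count_list (take (2 * h) (drop (d - h) w)) c" for w
  let ?A = "{\<omega> \<in> space M. xw \<omega> ! (d - h) \<noteq> c \<and> yw \<omega> = v}"
  let ?B = "{\<omega> \<in> space M. F (xsw \<omega>) \<and> yw \<omega> = v}"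
  let ?C = "{\<omega> \<in> space M. yw \<omega> = v}"
  have Bev: "?B \<in> events"
    using measurable_word_pred[OF random_variable_words(3,2), of "\<lambda>x y. F x \<and> y = v"] by simp
  have Cev: "?C \<in> events"
    using measurable_word_pred[OF random_variable_words(3,2), of "\<lambda>x y. y = v"] by simp
  have A: "prob ?A \<ge> 1 / 2 * (1 / 4 ^ d)"
  proof -
    have "prob ((\<lambda>\<omega>. (xw \<omega>, yw \<omega>)) -` ({w. w ! (d - h) \<noteq> c} \<times> {v}) \<inter> space M)
        = prob (xw -` {w. w ! (d - h) \<noteq> c} \<inter> space M) * prob (yw -` {v} \<inter> space M)"
      by (intro indep_varD[OF indep_X_Y]) auto
    moreover have "(\<lambda>\<omega>. (xw \<omega>, yw \<omega>)) -` ({w. w ! (d - h) \<noteq> c} \<times> {v}) \<inter> space M = ?A"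
      "xw -` {w. w ! (d - h) \<noteq> c} \<inter> space M = ?E c" "yw -` {v} \<inter> space M = ?C"
      by auto
    ultimately have "prob ?A = prob (?E c) * (1 / 4 ^ d)" using prob_yw[OF v] by simp
    then show ?thesis using mult_right_mono[OF c(2), of "1 / 4 ^ d"] by simp
  qed
  have B: "prob ?B \<ge> (1 / 2 + 1 / (2 * 4 ^ h)) * (1 / 4 ^ d)"
  proof -
    have "prob ?B = avg (2 * d) (\<lambda>x. avg (2 * d) (\<lambda>y. of_bool (F x \<and> y = v)))"
      by (rule uniform_pair_prob[OF uniform_pair_Xs])
    also have "\<dots> = avg (2 * d) (\<lambda>x. of_bool (F x)) * avg (2 * d) (\<lambda>y. of_bool (y = v))"
      by (simp only: of_bool_conj avg_cmult avg_mult_const)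
    also have "avg (2 * d) (\<lambda>y. of_bool (y = v)) = 1 / 4 ^ d"
      unfolding avg_eq_sum using v by (simp add: sum.If_cases of_bool_def power_mult)
    also have "avg (2 * d) (\<lambda>x. of_bool (F x)) = avg (2 * h) (\<lambda>w. of_bool (h \<le> count_list w c))"
    proof -
      have "avg (2 * d) (\<lambda>x. of_bool (F x)) = avg (2 * d - (d - h)) (\<lambda>w. of_bool (h \<le> count_list (take (2 * h) w) c))"
        unfolding F_def by (rule avg_drop) simp
      also have "\<dots> = avg (2 * h) (\<lambda>w. of_bool (h \<le> count_list w c))"
        using h by (intro avg_take) simp
      finally show ?thesis .
    qed
    finally show ?thesis
      using mult_right_mono[OF avg_majority[OF c(1), of h], of "1 / 4 ^ d"] by simp
  qed
  \<comment> \<open>Both events lie in \<open>?C\<close>, and their probabilities add up to more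
    than that of \<open>?C\<close>, so they overlap whatever the joint law.\<close>
  have "prob (?A \<union> ?B) \<le> prob ?C"
    using Cev by (intro finite_measure_mono) auto
  moreover have "prob (?A \<union> ?B) = prob ?A + prob ?B - prob (?A \<inter> ?B)"
    using finite_measure_Union'[of ?A ?B] finite_measure_Diff'[of ?B ?A] Eev(1) Bev
    by (simp add: Int_commute)
  ultimately have "1 / 4 ^ d * (1 / (2 * 4 ^ h)) \<le> prob (?A \<inter> ?B)"
    using A B prob_yw[OF v] by (simp add: algebra_simps)
  also have "\<dots> \<le> measure M (H_event M d \<tau> X Y Xs)"
  proof (rule finite_measure_mono_AE)
    show "AE \<omega>\<in>?A \<inter> ?B in M. \<omega> \<in> H_event M d \<tau> X Y Xs"
      using block_letter
    proof (eventually_elim, intro impI)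
      fix \<omega> assume b: "\<exists>b<2. X (d - h + 1) \<omega> = b \<and> (\<forall>i\<in>{d - h + 1..d + h}. X i \<omega> = b)" and \<omega>: "\<omega> \<in> ?A \<inter> ?B"
      then obtain b where b: "X (d - h + 1) \<omega> = b" "\<forall>i\<in>{d - h + 1..d + h}. X i \<omega> = b" by blast
      have "xw \<omega> ! (d - h) = X (d - h + 1) \<omega>"
        unfolding word_def using h by (subst nth_map) (auto simp del: upt_Suc)
      then have "b \<noteq> c" using \<omega> b(1) by auto
      \<comment> \<open>Against a word that consists of \<open>c\<close> only, the LCS length is the
        number of letters \<open>c\<close>.\<close>
      have count: "lcs_length w (yw \<omega>) = count_list w c" if "length w \<le> 2 * d" for w
        using \<omega> that lcs_length_replicate[of "2 * d" c w] count_le_length[of w c]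
        by (simp add: v_def lcs_length_commute)
      have "count_list (xw \<omega>) c = count_list (lw \<omega>) c + count_list (rw \<omega>) c"
        unfolding xw_block[OF b(2)] using \<open>b \<noteq> c\<close> by (simp add: count_list_0_iff)
      moreover have "xsw \<omega> = lw \<omega> @ word Xs (d - h + 1) (d + h) \<omega> @ rw \<omega>"
      proof -
        have "word Xs i j \<omega> = word X i j \<omega>" if "\<And>m. m \<in> {i..j} \<Longrightarrow> m \<in> {1..d - h} \<union> {d + h + 1..2 * d}" for i j
          unfolding word_def using that Xs_eq \<omega> by (intro map_cong) auto
        then have "word Xs 1 (d - h) \<omega> = lw \<omega>" "word Xs (d + h + 1) (2 * d) \<omega> = rw \<omega>" by auto
        then show ?thesis
          using word_append[of 1 "d - h" "2 * d" Xs \<omega>] word_append[of "d - h + 1" "d + h" "2 * d" Xs \<omega>] h by simp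
      qed
      moreover have "word Xs (d - h + 1) (d + h) \<omega> = take (2 * h) (drop (d - h) (xsw \<omega>))"
        using word_eq_drop_take[of "d - h + 1" "d + h" "2 * d" Xs \<omega>] h by (simp add: take_drop add.commute)
      then have "h \<le> count_list (word Xs (d - h + 1) (d + h) \<omega>) c" using \<omega> by (simp add: F_def)
      ultimately have "count_list (xw \<omega>) c + h \<le> count_list (xsw \<omega>) c" by simp
      then show "\<omega> \<in> H_event M d \<tau> X Y Xs"
        using \<omega> \<tau> count[of "xw \<omega>"] count[of "xsw \<omega>"] by (simp add: H_event_def)
    qed
  qed (rule H_event_sets)
  finally show ?thesis .
qed

end

section \<open>Rounding and the choice of constants\<close>

lemma round_pos_ge_half: "x - 1 / 2 \<le> real (round_pos x)"
proof -
  have "real_of_int (round x) \<ge> x - 1 / 2" using of_int_round_abs_le[of x] by linarith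
  moreover have "real (round_pos x) \<ge> real_of_int (round x)" by (simp add: round_pos_def)
  ultimately show ?thesis by linarith
qed

lemma round_pos_le_of_nat: "1 \<le> n \<Longrightarrow> x \<le> real n \<Longrightarrow> round_pos x \<le> n"
  using round_mono[of x "real n"] by (simp add: round_pos_def nat_le_iff)

text \<open>With slack for rounding, the conjuncts give in turn: the removed piece fits into the
  block; \<open>l + a \<le> \<rho> * d\<close>, for the slope bound; outer words of length at least
  \<open>K\<close>; a main term that dominates the errors of order \<open>d powr \<alpha>\<close>;
  and half of the exponent absorbing the factor \<open>20 * d\<close>.\<close>

lemma large_parameters:
  fixes \<alpha> \<beta> c \<eta> \<kappa> \<rho> C g :: real
  assumes "1 / 2 < \<alpha>" "\<alpha> < \<beta>" "\<beta> < 1" "0 < \<eta>" "0 < \<rho>" "c < g"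
  shows "\<forall>\<^sub>F d in sequentially. real d powr \<alpha> + 1 \<le> real d powr \<beta> - 2 \<and>
    real d powr \<beta> + 2 + (real d powr \<alpha> + 1) \<le> \<rho> * real d \<and>
    K + real d powr \<beta> / 2 + 1 \<le> real d \<and>
    C * real d powr \<alpha> + c * real d powr \<beta> \<le> g * (real d powr \<beta> - 2) \<and>
    20 * real d * exp (- \<eta>\<^sup>2 * real d powr (2 * \<alpha> - 1) / 2) \<le> exp (- (\<eta>\<^sup>2 / 4) * real d powr (2 * \<alpha> - 1))"
  using assms by (intro eventually_conj; real_asymp)

theorem theorem3p2:
  fixes \<alpha> \<beta> c\<^sub>H :: real
  assumes "2 * gamma_star 2 < 2"
    and "gamma 2 differentiable (at (p_M 2))"
    and "1/2 < \<alpha>" and "\<alpha> < \<beta>" and "\<beta> < 1"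
    and "c\<^sub>H > 0" and "c\<^sub>H < 3 * gamma_star 2 / 2 - 1"
  shows "\<exists>C\<^sub>G>0. \<exists>C\<^sub>H>0. \<forall>d\<ge>1. \<forall>(M :: 'w measure) X Y Xs.
    block_model M 2 d (round_even (real d powr \<beta>)) X Y Xs \<longrightarrow>
      measure M (G_event M d (round_even (real d powr \<beta>)) (round_pos (real d powr \<alpha>)) X Y)
        \<ge> 1 - exp (- C\<^sub>G * real d powr (2 * \<alpha> - 1)) \<and>
      measure M (H_event M d (c\<^sub>H * real d powr \<beta>) X Y Xs)
        \<ge> 1 - exp (- C\<^sub>H * real d powr (2 * \<alpha> - 1))"
proof -
  define \<gamma> e where "\<gamma> = gamma_star 2" and "e = 2 * \<alpha> - 1"
  \<comment> \<open>Positivity of \<open>c\<^sub>H\<close> forces \<open>\<gamma> > 2 / 3\<close>,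
    and \<open>\<gamma> \<le> 8 / 9\<close> forces \<open>c\<^sub>H < 1 / 3\<close>.\<close>
  have \<gamma>: "2 / 3 < \<gamma>" "\<gamma> \<le> 8 / 9" "c\<^sub>H < 1 / 3" "c\<^sub>H < 3 * \<gamma> / 2 - 1"
    using gamma_star_le assms(6,7) by (auto simp: \<gamma>_def)
  have e: "e > 0" using assms(3) by (simp add: e_def)
  obtain \<kappa> \<rho> m0 where \<kappa>: "\<kappa> < 1 / 2" "0 < \<rho>" "\<rho> < 1"
    and slope: "\<And>m n k. m \<ge> m0 \<Longrightarrow> (1 - \<rho>) * real m \<le> real n \<Longrightarrow> mlcs m (n + k) - mlcs m n \<le> \<kappa> * real k"
    by (rule mlcs_slope[OF assms(2)]) (use \<gamma> in \<open>auto simp: \<gamma>_def\<close>)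
  obtain C where C: "C > 0" "\<And>n. n \<ge> 1 \<Longrightarrow> \<gamma> * real n - C * real n powr \<alpha> \<le> mlcs n n"
    unfolding \<gamma>_def by (rule mlcs_rate[of \<alpha>]) (use assms(3-5) in auto)
  \<comment> \<open>Since \<open>a d\<close> is at least \<open>d powr \<alpha> / 2\<close>, the
    deviation \<open>t = \<eta> * d powr \<alpha>\<close> satisfies both bounds on \<open>t\<close>
    in \<open>prob_G_large\<close>.\<close>
  define \<eta> where "\<eta> = min (1 / 4) ((1 / 2 - \<kappa>) / 8)"
  have \<eta>: "0 < \<eta>" "\<eta> \<le> 1 / 4" "\<eta> \<le> (1 / 2 - \<kappa>) / 8"
    unfolding \<eta>_def using \<kappa>(1) by (auto intro: min.cobounded2)[2] (rule min.cobounded2)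
  define l a h where "l d = round_even (real d powr \<beta>)" and "a d = round_pos (real d powr \<alpha>)"
    and "h d = round_pos (real d powr \<beta> / 2)" for d
  have l: "l d = 2 * h d" for d by (simp add: l_def h_def round_even_def)
  have "\<forall>\<^sub>F d in sequentially. real d powr \<alpha> + 1 \<le> real d powr \<beta> - 2 \<and>
      real d powr \<beta> + 2 + (real d powr \<alpha> + 1) \<le> \<rho> * real d \<and>
      real m0 + real d powr \<beta> / 2 + 1 \<le> real d \<and>
      (C * 2 powr \<alpha> + 5 * \<eta>) * real d powr \<alpha> + c\<^sub>H * real d powr \<beta> \<le> (3 * \<gamma> / 2 - 1) * (real d powr \<beta> - 2) \<and>
      20 * real d * exp (- \<eta>\<^sup>2 * real d powr (2 * \<alpha> - 1) / 2) \<le> exp (- (\<eta>\<^sup>2 / 4) * real d powr (2 * \<alpha> - 1))"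
    using assms(3-5) \<eta>(1) \<kappa>(2) \<gamma>(4) by (rule large_parameters)
  then obtain N0 where N0: "\<And>d. d \<ge> N0 \<Longrightarrow> real d powr \<alpha> + 1 \<le> real d powr \<beta> - 2"
    "\<And>d. d \<ge> N0 \<Longrightarrow> real d powr \<beta> + 2 + (real d powr \<alpha> + 1) \<le> \<rho> * real d"
    "\<And>d. d \<ge> N0 \<Longrightarrow> real m0 + real d powr \<beta> / 2 + 1 \<le> real d"
    "\<And>d. d \<ge> N0 \<Longrightarrow> (C * 2 powr \<alpha> + 5 * \<eta>) * real d powr \<alpha> + c\<^sub>H * real d powr \<beta> \<le> (3 * \<gamma> / 2 - 1) * (real d powr \<beta> - 2)"
    "\<And>d. d \<ge> N0 \<Longrightarrow> 20 * real d * exp (- \<eta>\<^sup>2 * real d powr e / 2) \<le> exp (- (\<eta>\<^sup>2 / 4) * real d powr e)"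
    unfolding eventually_sequentially e_def by blast
  \<comment> \<open>For \<open>d < N\<close> both lower bounds for small \<open>d\<close> are at
    least \<open>\<delta>\<close>, as \<open>h \<le> d\<close> gives
    \<open>4 ^ d * 4 ^ h \<le> 16 ^ N\<close>.\<close>
  define N \<delta> where "N = max 1 N0" and "\<delta> = 1 / (2 * 16 ^ N :: real)"
  have "1 \<le> (16 :: real) ^ N" by simp
  then have "1 < 2 * (16 :: real) ^ N" by linarith
  then have \<delta>: "0 < \<delta>" "\<delta> < 1" by (simp_all add: \<delta>_def)
  \<comment> \<open>One constant serves both events; it is fixed before \<open>d\<close> and the
    model.\<close>
  define C' where "C' = min (\<eta>\<^sup>2 / 4) (- ln (1 - \<delta>) / real N powr e)"
  have C': "C' > 0" using \<eta> \<delta> by (auto simp: C'_def N_def divide_neg_pos)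
  have main: "measure M (G_event M d (l d) (a d) X Y) \<ge> 1 - exp (- C' * real d powr e) \<and>
      measure M (H_event M d (c\<^sub>H * real d powr \<beta>) X Y Xs) \<ge> 1 - exp (- C' * real d powr e)"
    if d: "d \<ge> 1" and model: "block_model M 2 d (l d) X Y Xs" for d and M :: "'w measure" and X Y Xs
  proof -
    define x where "x = real d powr \<beta>"
    have x: "1 \<le> x" "x \<le> real d"
      using d assms(3-5) powr_mono[of \<beta> 1 "real d"] by (auto simp: x_def ge_one_powr_ge_zero)
    have h1: "1 \<le> h d" unfolding h_def by (rule round_pos_ge)
    have h2: "h d \<le> d" unfolding h_def using d x by (intro round_pos_le_of_nat) (auto simp: x_def)
    have h3: "x / 2 - 1 / 2 \<le> real (h d)" "real (h d) \<le> x / 2 + 1"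
      using round_pos_ge_half[of "x / 2"] round_pos_close[of "x / 2"] x unfolding h_def x_def by auto
    have a1: "1 \<le> a d" unfolding a_def by (rule round_pos_ge)
    have a2: "real d powr \<alpha> / 2 \<le> real (a d)" "real (a d) \<le> real d powr \<alpha> + 1"
      using round_pos_ge_half[of "real d powr \<alpha>"] round_pos_close[of "real d powr \<alpha>"] a1 d
      unfolding a_def by auto
    interpret binary_block_model M d "h d" X Y Xs
      using model h1 h2 unfolding l binary_block_model_def binary_block_model_axioms_def by simp
    define t where "t = \<eta> * real d powr \<alpha>"
    have t: "0 \<le> t" using \<eta> by (simp add: t_def)
    have exponent: "- t\<^sup>2 / (2 * real d) = - \<eta>\<^sup>2 * real d powr e / 2"
    proof -
      have "(real d powr \<alpha>)\<^sup>2 = real d powr e * real d"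
        using d by (simp add: e_def powr_diff powr_numeral powr_power mult.commute)
      then show ?thesis using d by (simp add: t_def power_mult_distrib)
    qed
    have tail: "20 * real d * exp (- t\<^sup>2 / (2 * real d)) \<le> exp (- (\<eta>\<^sup>2 / 4) * real d powr e)" if "d \<ge> N0"
      unfolding exponent by (rule N0(5)[OF that])
    have \<delta>_le: "\<delta> \<le> 1 / 4 ^ d * (1 / (2 * 4 ^ h d))" "\<delta> \<le> 1 / 4 ^ d" if "d < N"
    proof -
      have "4 ^ d * 4 ^ h d \<le> (4 ^ N * 4 ^ N :: real)"
        using that h2 by (intro mult_mono power_increasing) auto
      also have "\<dots> = 16 ^ N" by (simp flip: power_mult_distrib)
      finally show *: "\<delta> \<le> 1 / 4 ^ d * (1 / (2 * 4 ^ h d))"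
        unfolding \<delta>_def by (simp add: frac_le)
      have "1 \<le> (4 :: real) ^ h d" by simp
      then have "1 \<le> 2 * (4 :: real) ^ h d" by linarith
      then have "1 / (2 * 4 ^ h d) \<le> (1 :: real)" by (simp add: divide_le_eq)
      then have "1 / 4 ^ d * (1 / (2 * 4 ^ h d)) \<le> 1 / 4 ^ d * (1 :: real)"
        by (intro mult_left_mono) auto
      then show "\<delta> \<le> 1 / 4 ^ d" using * by simp
    qed
    note combine = exp_rate_combine[where ?d0.0 = N and d = d and e = e and \<delta> = \<delta> and c = "\<eta>\<^sup>2 / 4", folded C'_def]
    have G: "1 - exp (- C' * real d powr e) \<le> measure M (G_event M d (2 * h d) (a d) X Y)"
    proof (rule combine)
      assume "N \<le> d"
      then have dN: "d \<ge> N0" by (simp add: N_def)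
      have al: "real (a d) \<le> real (2 * h d)" "real (2 * h d + a d) \<le> \<rho> * real d"
        using N0(1,2)[OF dN] h3 a2 unfolding x_def by auto
      have "\<rho> * real d \<le> 1 * real d" using \<kappa> by (intro mult_right_mono) auto
      then have ad: "2 * h d + a d \<le> d" using al(2) by linarith
      have t1: "2 * t \<le> real (a d)"
        using a2(1) mult_right_mono[OF \<eta>(2), of "real d powr \<alpha>"] by (simp add: t_def)
      have "4 * \<eta> * real d powr \<alpha> \<le> (1 / 2 - \<kappa>) / 2 * real d powr \<alpha>"
        using \<eta>(3) by (intro mult_right_mono) auto
      also have "\<dots> = (1 / 2 - \<kappa>) * (real d powr \<alpha> / 2)" by simp
      also have "\<dots> \<le> (1 / 2 - \<kappa>) * real (a d)"
        using \<kappa> a2(1) by (intro mult_left_mono) auto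
      finally have t2: "4 * t \<le> (1 / 2 - \<kappa>) * real (a d)" by (simp add: t_def mult.assoc)
      have "1 - 20 * real d * exp (- t\<^sup>2 / (2 * real d)) \<le> measure M (G_event M d (2 * h d) (a d) X Y)"
      proof (rule prob_G_large[OF a1 _ ad t t1 t2])
        show "a d \<le> 2 * h d" using al(1) by linarith
        fix n k assume n: "d - 2 * h d - a d \<le> n"
        show "mlcs (d - h d) (n + k) - mlcs (d - h d) n \<le> \<kappa> * real k"
        proof (rule slope)
          have "real m0 \<le> real (d - h d)"
            using N0(3)[OF dN] h3 h2 unfolding x_def by (simp add: of_nat_diff)
          then show "m0 \<le> d - h d" by linarith
          \<comment> \<open>The slope bound applies because \<open>l + a \<le> \<rho> * d\<close>
            keeps \<open>n\<close> above \<open>(1 - \<rho>) * d\<close>.\<close>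
          have "(1 - \<rho>) * real (d - h d) \<le> (1 - \<rho>) * real d"
            using \<kappa> by (intro mult_left_mono) auto
          also have "\<dots> \<le> real d - real (2 * h d + a d)" using al(2) by (simp add: algebra_simps)
          also have "\<dots> \<le> real n" using n by linarith
          finally show "(1 - \<rho>) * real (d - h d) \<le> real n" .
        qed
      qed
      then show "1 - exp (- (\<eta>\<^sup>2 / 4) * real d powr e) \<le> measure M (G_event M d (2 * h d) (a d) X Y)"
        using tail[OF dN] by linarith
    next
      assume "d < N"
      then show "\<delta> \<le> measure M (G_event M d (2 * h d) (a d) X Y)"
        using \<delta>_le prob_G_ge[OF a1] by linarith
    qed (use d e \<delta> in \<open>auto simp: N_def\<close>)
    have H: "1 - exp (- C' * real d powr e) \<le> measure M (H_event M d (c\<^sub>H * real d powr \<beta>) X Y Xs)"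
    proof (rule combine)
      assume "N \<le> d"
      then have dN: "d \<ge> N0" by (simp add: N_def)
      have "\<gamma> * (2 * real d) - C * (2 powr \<alpha> * real d powr \<alpha>) \<le> mlcs (2 * d) (2 * d)"
        using C(2)[of "2 * d"] d by (simp add: powr_mult)
      moreover have "(3 * \<gamma> / 2 - 1) * (x - 2) \<le> (3 * \<gamma> / 2 - 1) * (2 * real (h d))"
        using \<gamma> h3 by (intro mult_left_mono) auto
      moreover have "(C * 2 powr \<alpha> + 5 * \<eta>) * real d powr \<alpha> = C * (2 powr \<alpha> * real d powr \<alpha>) + 5 * t"
        by (simp add: t_def algebra_simps)
      ultimately have "c\<^sub>H * real d powr \<beta>
          \<le> mlcs (2 * d) (2 * d) - \<gamma> * (2 * real d) + (3 * \<gamma> / 2 - 1) * (2 * real (h d)) - 5 * t"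
        using N0(4)[OF dN] unfolding x_def by linarith
      then have "1 - 20 * real d * exp (- t\<^sup>2 / (2 * real d)) \<le> measure M (H_event M d (c\<^sub>H * real d powr \<beta>) X Y Xs)"
        unfolding \<gamma>_def by (rule prob_H_large[OF t])
      then show "1 - exp (- (\<eta>\<^sup>2 / 4) * real d powr e) \<le> measure M (H_event M d (c\<^sub>H * real d powr \<beta>) X Y Xs)"
        using tail[OF dN] by linarith
    next
      assume "d < N"
      have "c\<^sub>H * x \<le> 1 / 3 * x" using \<gamma> x by (intro mult_right_mono) auto
      \<comment> \<open>For \<open>x < 3\<close> this follows from \<open>h \<ge> 1\<close>,
        otherwise from \<open>h \<ge> x / 2 - 1 / 2 \<ge> x / 3\<close>.\<close>
      also have "\<dots> \<le> real (h d)" using h1 h3 by (cases "x < 3") auto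
      finally show "\<delta> \<le> measure M (H_event M d (c\<^sub>H * real d powr \<beta>) X Y Xs)"
        using \<delta>_le(1)[OF \<open>d < N\<close>] prob_H_ge unfolding x_def by (meson order_trans)
    qed (use d e \<delta> in \<open>auto simp: N_def\<close>)
    show ?thesis using G H unfolding l by blast
  qed
  show ?thesis
    using main C' unfolding l_def a_def e_def by blast
qed

end
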